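(* Let $C$ be a smooth irreducible projective curve of genus $g\ge 2$ and gonality $\gamma$ over an algebraically closed field of characteristic zero. Let $L$ be a globally generated line bundle of degree $d$ on $C$ with $h^0(C,L)=r+1$, and let $B$ be a line bundle on $C$ with $|B|=g^1_\gamma$, i.e. $\deg(B)=\gamma$ and $h^0(C,B)=2$. Suppose that $d>\gamma\cdot r$. If the multiplication map $$\mu_L^{\gamma}: H^0(C,L)\otimes H^0(C,B)\to H^0(C,L\otimes B)$$ is not injective, then $(L,H^0(C,L))$ is not linearly semistable.
   Context: The gonality of $C$ is the minimal degree of a nonconstant morphism $C\to\mathbb P^1$. Linear semistability: $(L,H^0(C,L))$ with $h^0(C,L)=r+1$ is linearly semistable if for every linear subspace $W\subset H^0(C,L)$ of dimension $w\ge 2$ one has $\frac{\deg(L')}{w-1}\ge\frac{\deg(L)}{r}$, where $L'\subseteq L$ is the line bundle generated by $W$, i.e. the image of $W\otimes\mathcal O_C\to L$. *)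

theory Defs
  imports "HOL-Analysis.Analysis" "HOL-Computational_Algebra.Polynomial"
    "HOL-Library.Function_Algebras"
begin

section \<open>Spaces of functions with values in a field\<close>

text \<open>
  Addition and multiplication of functions are pointwise (\<^theory>\<open>HOL-Library.Function_Algebras\<close>).
  Dimensions are taken in the resulting vector spaces; as usual in the library the dimension of an
  infinite-dimensional space is 0.
\<close>

definition fscale :: "'k::field \<Rightarrow> ('a \<Rightarrow> 'k) \<Rightarrow> 'a \<Rightarrow> 'k" where
  "fscale c f = (\<lambda>x. c * f x)"

global_interpretation fun_vs: vector_space fscale
  by unfold_locales (auto simp: fscale_def algebra_simps fun_eq_iff)


section \<open>The Zariski topology on projective space\<close>

text \<open>
  A point of the projective space of \<open>'k ^ 'n\<close> (of dimension \<open>CARD('n) - 1\<close>) is a line through the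
  origin.
\<close>

type_synonym ('k, 'n) point = "('k ^ 'n) set"

definition proj_space :: "('k::field, 'n::finite) point set" where
  "proj_space = {vec.span {v} | v. v \<noteq> 0}"

text \<open>
  Homogeneous polynomials are represented by the functions they define; over an infinite field
  this loses nothing. The zero function is homogeneous of every degree.
\<close>

inductive hom_poly :: "nat \<Rightarrow> (('k::field) ^ ('n::finite) \<Rightarrow> 'k) \<Rightarrow> bool" where
  const: "hom_poly 0 (\<lambda>v. a)"
| coord: "hom_poly 1 (\<lambda>v. v $ i)"
| add: "hom_poly m F \<Longrightarrow> hom_poly m G \<Longrightarrow> hom_poly m (\<lambda>v. F v + G v)"
| mult: "hom_poly l F \<Longrightarrow> hom_poly m G \<Longrightarrow> hom_poly (l + m) (\<lambda>v. F v * G v)"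

definition zero_locus :: "(('k::field) ^ ('n::finite) \<Rightarrow> 'k) set \<Rightarrow> ('k, 'n) point set" where
  "zero_locus T = {P \<in> proj_space. \<forall>F\<in>T. \<forall>v\<in>P. F v = 0}"

definition algebraic_set :: "('k::field, 'n::finite) point set \<Rightarrow> bool" where
  "algebraic_set Z \<longleftrightarrow> (\<exists>T. (\<forall>F\<in>T. \<exists>m. hom_poly m F) \<and> Z = zero_locus T)"

definition zariski :: "('k::field, 'n::finite) point topology" where
  "zariski = topology (\<lambda>U. U \<subseteq> proj_space \<and> algebraic_set (proj_space - U))"

lemma hom_poly_scale:
  "hom_poly m F \<Longrightarrow> F (c *s v) = c ^ m * F v"
  by (induction rule: hom_poly.induct) (auto simp: algebra_simps power_add)

lemma algebraic_set_Un:
  assumes "algebraic_set Y" "algebraic_set Z"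
  shows "algebraic_set (Y \<union> Z)"
proof -
  obtain S T where S: "\<forall>F\<in>S. \<exists>m. hom_poly m F" "Y = zero_locus S"
    and T: "\<forall>F\<in>T. \<exists>m. hom_poly m F" "Z = zero_locus T"
    using assms unfolding algebraic_set_def by auto
  define R where "R = {(\<lambda>v. F v * G v) | F G. F \<in> S \<and> G \<in> T}"
  have R: "\<forall>F\<in>R. \<exists>m. hom_poly m F"
    unfolding R_def using S(1) T(1) hom_poly.mult by blast
  have "zero_locus S \<union> zero_locus T = zero_locus R"
  proof (intro equalityI subsetI)
    fix P assume "P \<in> zero_locus S \<union> zero_locus T"
    then show "P \<in> zero_locus R" unfolding zero_locus_def R_def by auto
  next
    fix P assume P: "P \<in> zero_locus R"
    then obtain u where u: "P = vec.span {u}" "P \<in> proj_space"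
      unfolding zero_locus_def proj_space_def by auto
    have line: "v \<in> P \<Longrightarrow> \<exists>c. v = c *s u" for v
      using u(1) by (auto simp: vec.span_singleton)
    show "P \<in> zero_locus S \<union> zero_locus T"
    proof (rule ccontr)
      assume "\<not> ?thesis"
      then obtain F G v w where *: "F \<in> S" "v \<in> P" "F v \<noteq> 0" "G \<in> T" "w \<in> P" "G w \<noteq> 0"
        using u(2) unfolding zero_locus_def by auto
      have "F u \<noteq> 0" using *(1-3) S(1) line[of v] hom_poly_scale by (metis mult_zero_right)
      moreover have "G u \<noteq> 0" using *(4-6) T(1) line[of w] hom_poly_scale by (metis mult_zero_right)
      moreover have "F u * G u = 0"
      proof -
        have FG: "(\<lambda>v. F v * G v) \<in> R" unfolding R_def using *(1,4) by blast
        have E: "\<forall>E\<in>R. \<forall>v\<in>P. E v = 0" using P unfolding zero_locus_def by simp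
        have "u \<in> P" unfolding u(1) by (simp add: vec.span_base)
        then show ?thesis using bspec[OF bspec[OF E FG]] by simp
      qed
      ultimately show False by simp
    qed
  qed
  then have "Y \<union> Z = zero_locus R" unfolding S(2) T(2) .
  then show ?thesis unfolding algebraic_set_def using R by (intro exI[of _ R] conjI)
qed

lemma algebraic_set_Inter:
  assumes "\<And>Z. Z \<in> \<Z> \<Longrightarrow> algebraic_set Z"
  shows "algebraic_set (proj_space \<inter> \<Inter>\<Z>)"
proof -
  obtain T where T: "\<And>Z. Z \<in> \<Z> \<Longrightarrow> (\<forall>F\<in>T Z. \<exists>m. hom_poly m F) \<and> Z = zero_locus (T Z)"
    using assms unfolding algebraic_set_def by metis
  have "proj_space \<inter> \<Inter>\<Z> = zero_locus (\<Union>Z\<in>\<Z>. T Z)"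
  proof (intro equalityI subsetI)
    fix P assume P: "P \<in> proj_space \<inter> \<Inter>\<Z>"
    then have "P \<in> zero_locus (T Z)" if "Z \<in> \<Z>" for Z using T[OF that] that by blast
    then show "P \<in> zero_locus (\<Union>Z\<in>\<Z>. T Z)" using P unfolding zero_locus_def by blast
  next
    fix P assume P: "P \<in> zero_locus (\<Union>Z\<in>\<Z>. T Z)"
    have "P \<in> zero_locus (T Z)" if "Z \<in> \<Z>" for Z using P that unfolding zero_locus_def by blast
    then have "P \<in> Z" if "Z \<in> \<Z>" for Z using T[OF that] that by blast
    then show "P \<in> proj_space \<inter> \<Inter>\<Z>" using P unfolding zero_locus_def by blast
  qed
  moreover have "\<forall>F\<in>(\<Union>Z\<in>\<Z>. T Z). \<exists>m. hom_poly m F" using T by blast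
  ultimately show ?thesis unfolding algebraic_set_def by blast
qed

lemma algebraic_set_empty: "algebraic_set ({} :: ('k::field, 'n::finite) point set)"
proof -
  have "({} :: ('k, 'n) point set) = zero_locus {\<lambda>v::'k ^ 'n. 1 :: 'k}"
    unfolding zero_locus_def proj_space_def by (auto intro: vec.span_zero)
  moreover have "hom_poly 0 (\<lambda>v::'k ^ 'n. 1 :: 'k)" by (rule hom_poly.const)
  ultimately show ?thesis
    unfolding algebraic_set_def by (intro exI[of _ "{\<lambda>v. 1}"] conjI) auto
qed

lemma istopology_zariski:
  "istopology (\<lambda>U. U \<subseteq> proj_space \<and> algebraic_set (proj_space - U))"
  unfolding istopology_def
proof (intro conjI allI impI)
  fix S T :: "('k::field, 'n::finite) point set"
  assume *: "S \<subseteq> proj_space \<and> algebraic_set (proj_space - S)"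
    "T \<subseteq> proj_space \<and> algebraic_set (proj_space - T)"
  then show "S \<inter> T \<subseteq> proj_space" by blast
  show "algebraic_set (proj_space - S \<inter> T)"
    using algebraic_set_Un * by (metis Diff_Int)
next
  fix \<U> :: "('k::field, 'n::finite) point set set"
  assume *: "\<forall>U\<in>\<U>. U \<subseteq> proj_space \<and> algebraic_set (proj_space - U)"
  then show "\<Union>\<U> \<subseteq> proj_space" by blast
  have "algebraic_set (proj_space \<inter> \<Inter>((\<lambda>U. proj_space - U) ` \<U>))"
    by (rule algebraic_set_Inter) (use * in blast)
  moreover have "proj_space \<inter> \<Inter>((\<lambda>U. proj_space - U) ` \<U>) = proj_space - \<Union>\<U>" by blast
  ultimately show "algebraic_set (proj_space - \<Union>\<U>)" by simp
qed

lemma openin_zariski: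
  "openin zariski U \<longleftrightarrow> U \<subseteq> proj_space \<and> algebraic_set (proj_space - U)"
  unfolding zariski_def by (simp add: topology_inverse'[OF istopology_zariski])

lemma topspace_zariski: "topspace zariski = proj_space"
proof -
  have "openin zariski proj_space" by (simp add: openin_zariski algebraic_set_empty)
  then have "proj_space \<subseteq> topspace zariski" by (rule openin_subset)
  moreover have "topspace zariski \<subseteq> proj_space"
    using openin_topspace[of zariski] unfolding openin_zariski by blast
  ultimately show ?thesis by blast
qed

lemma closedin_zariski: "closedin zariski Z \<longleftrightarrow> algebraic_set Z"
proof -
  have "Z \<subseteq> proj_space" if "algebraic_set Z"
    using that unfolding algebraic_set_def zero_locus_def by auto
  then show ?thesis
    unfolding closedin_def topspace_zariski openin_zariski by (metis Diff_subset double_diff subset_refl)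
qed

abbreviation zar :: "('k::field, 'n::finite) point set \<Rightarrow> ('k, 'n) point topology" where
  "zar X \<equiv> subtopology zariski X"

definition irreducible_closed :: "'a topology \<Rightarrow> 'a set \<Rightarrow> bool" where
  "irreducible_closed T S \<longleftrightarrow> closedin T S \<and> S \<noteq> {} \<and>
     (\<forall>Y Z. closedin T Y \<and> closedin T Z \<and> S = Y \<union> Z \<longrightarrow> S = Y \<or> S = Z)"

definition irreducible_chain :: "'a topology \<Rightarrow> nat \<Rightarrow> (nat \<Rightarrow> 'a set) \<Rightarrow> bool" where
  "irreducible_chain T n Z \<longleftrightarrow>
     (\<forall>i\<le>n. irreducible_closed T (Z i)) \<and> (\<forall>i<n. Z i \<subset> Z (Suc i))"

definition has_krull_dim :: "'a topology \<Rightarrow> nat \<Rightarrow> bool" where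
  "has_krull_dim T n \<longleftrightarrow>
     (\<exists>Z. irreducible_chain T n Z) \<and> \<not> (\<exists>Z. irreducible_chain T (Suc n) Z)"


section \<open>Regular functions\<close>

definition regular_on ::
  "('k::field, 'n::finite) point set \<Rightarrow> ('k, 'n) point set \<Rightarrow> (('k, 'n) point \<Rightarrow> 'k) \<Rightarrow> bool" where
  "regular_on X U f \<longleftrightarrow> (\<forall>P\<in>U. \<exists>V. openin (zar X) V \<and> P \<in> V \<and> V \<subseteq> U \<and>
     (\<exists>m G H. hom_poly m G \<and> hom_poly m H \<and>
        (\<forall>Q\<in>V. \<forall>v\<in>Q. v \<noteq> 0 \<longrightarrow> H v \<noteq> 0 \<and> f Q = G v / H v)))"

text \<open>
  Sections over \<open>U\<close> of a sheaf of functions are extended by 0 outside \<open>U\<close>, so that they are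
  determined by their values on \<open>U\<close>.
\<close>

definition supported_on :: "'a set \<Rightarrow> ('a \<Rightarrow> 'k::zero) \<Rightarrow> bool" where
  "supported_on U s \<longleftrightarrow> (\<forall>P. P \<notin> U \<longrightarrow> s P = 0)"

definition restr :: "'a set \<Rightarrow> ('a \<Rightarrow> 'k::zero) \<Rightarrow> 'a \<Rightarrow> 'k" where
  "restr V s = (\<lambda>P. if P \<in> V then s P else 0)"

type_synonym ('k, 'n) fun_sheaf = "('k, 'n) point set \<Rightarrow> (('k, 'n) point \<Rightarrow> 'k) set"

definition struct_sheaf :: "('k::field, 'n::finite) point set \<Rightarrow> ('k, 'n) fun_sheaf" where
  "struct_sheaf X U = {f. supported_on U f \<and> regular_on X U f}"

text \<open>
  Elements of local rings and rational functions are represented by total functions that are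
  regular near \<open>P\<close>, respectively on some nonempty open set; two of them represent the same
  germ, respectively rational function, if they agree near \<open>P\<close>, respectively generically.
\<close>

definition eq_near ::
  "('k::field, 'n::finite) point set \<Rightarrow> ('k, 'n) point \<Rightarrow>
     (('k, 'n) point \<Rightarrow> 'k) \<Rightarrow> (('k, 'n) point \<Rightarrow> 'k) \<Rightarrow> bool" where
  "eq_near X P f g \<longleftrightarrow> (\<exists>U. openin (zar X) U \<and> P \<in> U \<and> (\<forall>Q\<in>U. f Q = g Q))"

definition eq_generic ::
  "('k::field, 'n::finite) point set \<Rightarrow>
     (('k, 'n) point \<Rightarrow> 'k) \<Rightarrow> (('k, 'n) point \<Rightarrow> 'k) \<Rightarrow> bool" where
  "eq_generic X f g \<longleftrightarrow> (\<exists>U. openin (zar X) U \<and> U \<noteq> {} \<and> (\<forall>Q\<in>U. f Q = g Q))"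

definition local_ring ::
  "('k::field, 'n::finite) point set \<Rightarrow> ('k, 'n) point \<Rightarrow> (('k, 'n) point \<Rightarrow> 'k) set" where
  "local_ring X P = {f. \<exists>U. openin (zar X) U \<and> P \<in> U \<and> regular_on X U f}"

definition rat_fun :: "('k::field, 'n::finite) point set \<Rightarrow> (('k, 'n) point \<Rightarrow> 'k) set" where
  "rat_fun X = {f. \<exists>U. openin (zar X) U \<and> U \<noteq> {} \<and> regular_on X U f}"

definition max_ideal ::
  "('k::field, 'n::finite) point set \<Rightarrow> ('k, 'n) point \<Rightarrow> (('k, 'n) point \<Rightarrow> 'k) set" where
  "max_ideal X P = {f \<in> local_ring X P. f P = 0}"

definition max_ideal_sq ::
  "('k::field, 'n::finite) point set \<Rightarrow> ('k, 'n) point \<Rightarrow> (('k, 'n) point \<Rightarrow> 'k) set" where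
  "max_ideal_sq X P = {f \<in> local_ring X P. \<exists>(n::nat) a b.
     (\<forall>i<n. a i \<in> max_ideal X P \<and> b i \<in> max_ideal X P) \<and>
     eq_near X P f (\<lambda>Q. \<Sum>i<n. a i Q * b i Q)}"


section \<open>Smooth projective curves\<close>

text \<open>
  On a curve, \<open>P\<close> is smooth iff the local ring at \<open>P\<close> is regular, i.e. the cotangent space
  \<open>max_ideal / max_ideal_sq\<close> is one-dimensional (spanned by the class of some nonzero \<open>t\<close>).
\<close>

definition smooth_curve_point ::
  "('k::field, 'n::finite) point set \<Rightarrow> ('k, 'n) point \<Rightarrow> bool" where
  "smooth_curve_point C P \<longleftrightarrow> (\<exists>t\<in>max_ideal C P. t \<notin> max_ideal_sq C P \<and>
     (\<forall>f\<in>max_ideal C P. \<exists>c. f - fscale c t \<in> max_ideal_sq C P))"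

definition smooth_projective_curve :: "('k::field, 'n::finite) point set \<Rightarrow> bool" where
  "smooth_projective_curve C \<longleftrightarrow> irreducible_closed zariski C \<and> has_krull_dim (zar C) 1 \<and>
     (\<forall>P\<in>C. smooth_curve_point C P)"

text \<open>
  The tangent space at \<open>P\<close>, as the space of point derivations of the local ring. Values on
  functions that are not regular at \<open>P\<close> are normalised to 0.
\<close>

definition tangent_space ::
  "('k::field, 'n::finite) point set \<Rightarrow> ('k, 'n) point \<Rightarrow> ((('k, 'n) point \<Rightarrow> 'k) \<Rightarrow> 'k) set" where
  "tangent_space X P = {D.
     (\<forall>f. f \<notin> local_ring X P \<longrightarrow> D f = 0) \<and>
     (\<forall>f\<in>local_ring X P. \<forall>g\<in>local_ring X P.
        D (f + g) = D f + D g \<and> D (f * g) = f P * D g + g P * D f \<and>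
        (eq_near X P f g \<longrightarrow> D f = D g)) \<and>
     (\<forall>c. \<forall>f\<in>local_ring X P. D (fscale c f) = c * D f)}"

text \<open>
  Global regular differential 1-forms, as functions on the tangent bundle that are locally of the
  form \<open>\<Sum> f\<^sub>i dg\<^sub>i\<close> with \<open>f\<^sub>i\<close>, \<open>g\<^sub>i\<close> regular, where \<open>dg (P, D) = D g\<close>.
\<close>

definition regular_forms ::
  "('k::field, 'n::finite) point set \<Rightarrow>
     (('k, 'n) point \<times> ((('k, 'n) point \<Rightarrow> 'k) \<Rightarrow> 'k) \<Rightarrow> 'k) set" where
  "regular_forms X = {\<omega>. supported_on (Sigma X (tangent_space X)) \<omega> \<and>
     (\<forall>P\<in>X. \<exists>U. openin (zar X) U \<and> P \<in> U \<and>
        (\<exists>(n::nat) f g. (\<forall>i<n. regular_on X U (f i) \<and> regular_on X U (g i)) \<and>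
           (\<forall>Q\<in>U. \<forall>D\<in>tangent_space X Q. \<omega> (Q, D) = (\<Sum>i<n. f i Q * D (g i)))))}"

definition genus :: "('k::field, 'n::finite) point set \<Rightarrow> nat" where
  "genus C = fun_vs.dim (regular_forms C)"

definition morphism ::
  "('k::field, 'n::finite) point set \<Rightarrow> ('k, 'm::finite) point set \<Rightarrow>
     (('k, 'n) point \<Rightarrow> ('k, 'm) point) \<Rightarrow> bool" where
  "morphism X Y \<phi> \<longleftrightarrow> continuous_map (zar X) (zar Y) \<phi> \<and>
     (\<forall>V f. openin (zar Y) V \<and> regular_on Y V f \<longrightarrow>
        regular_on X {P \<in> X. \<phi> P \<in> V} (f \<circ> \<phi>))"

text \<open>
  The degree of the extension of the function field of \<open>Y\<close> by that of \<open>X\<close> given by a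
  nonconstant morphism \<open>\<phi>\<close> to the curve \<open>Y\<close>: \<open>e 0, \<dots>, e (m - 1)\<close> is a basis.
\<close>

definition morphism_has_degree ::
  "('k::field, 'n::finite) point set \<Rightarrow> ('k, 'm::finite) point set \<Rightarrow>
     (('k, 'n) point \<Rightarrow> ('k, 'm) point) \<Rightarrow> nat \<Rightarrow> bool" where
  "morphism_has_degree X Y \<phi> m \<longleftrightarrow> (\<exists>e. (\<forall>i<m. e i \<in> rat_fun X) \<and>
     (\<forall>f\<in>rat_fun X. \<exists>c. (\<forall>i<m. c i \<in> rat_fun Y) \<and>
        eq_generic X f (\<lambda>P. \<Sum>i<m. c i (\<phi> P) * e i P)) \<and>
     (\<forall>c. (\<forall>i<m. c i \<in> rat_fun Y) \<and> eq_generic X (\<lambda>P. \<Sum>i<m. c i (\<phi> P) * e i P) (\<lambda>_. 0) \<longrightarrow>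
        (\<forall>i<m. eq_generic Y (c i) (\<lambda>_. 0))))"

definition gonality :: "('k::field, 'n::finite) point set \<Rightarrow> nat" where
  "gonality C = (LEAST m. \<exists>\<phi>. morphism C (proj_space :: ('k, 2) point set) \<phi> \<and>
     \<not> (\<exists>p. \<forall>P\<in>C. \<phi> P = p) \<and> morphism_has_degree C proj_space \<phi> m)"


section \<open>Line bundles\<close>

text \<open>
  A line bundle is an invertible sheaf, realised as a sheaf of \<open>'k\<close>-valued functions. Every
  invertible sheaf \<open>F\<close> on \<open>X\<close> is isomorphic to such a sheaf: choose a basis of each fibre
  \<open>F(P)\<close> and send a section to the function of its values; local generators then become functions
  without zeros, which need not be regular. To also cover invertible subsheaves, a local generator
  is only required to be generically nonzero.
\<close>

definition frame ::
  "('k::field, 'n::finite) point set \<Rightarrow> ('k, 'n) fun_sheaf \<Rightarrow> ('k, 'n) point set \<Rightarrow>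
     (('k, 'n) point \<Rightarrow> 'k) \<Rightarrow> bool" where
  "frame X F U e \<longleftrightarrow> openin (zar X) U \<and> e \<in> F U \<and>
     (\<exists>V. openin (zar X) V \<and> V \<noteq> {} \<and> V \<subseteq> U \<and> (\<forall>Q\<in>V. e Q \<noteq> 0)) \<and>
     (\<forall>V. openin (zar X) V \<and> V \<subseteq> U \<longrightarrow> F V = (\<lambda>f. f * e) ` struct_sheaf X V)"

definition module_sheaf ::
  "('k::field, 'n::finite) point set \<Rightarrow> ('k, 'n) fun_sheaf \<Rightarrow> bool" where
  "module_sheaf X F \<longleftrightarrow> (\<forall>U. openin (zar X) U \<longrightarrow>
     0 \<in> F U \<and>
     (\<forall>s\<in>F U. supported_on U s) \<and>
     (\<forall>s\<in>F U. \<forall>t\<in>F U. s + t \<in> F U) \<and>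
     (\<forall>f\<in>struct_sheaf X U. \<forall>s\<in>F U. f * s \<in> F U) \<and>
     (\<forall>V. \<forall>s\<in>F U. openin (zar X) V \<and> V \<subseteq> U \<longrightarrow> restr V s \<in> F V) \<and>
     (\<forall>s. supported_on U s \<and>
        (\<forall>P\<in>U. \<exists>V. openin (zar X) V \<and> P \<in> V \<and> V \<subseteq> U \<and> restr V s \<in> F V) \<longrightarrow> s \<in> F U))"

definition line_bundle ::
  "('k::field, 'n::finite) point set \<Rightarrow> ('k, 'n) fun_sheaf \<Rightarrow> bool" where
  "line_bundle X F \<longleftrightarrow> module_sheaf X F \<and> (\<forall>P\<in>X. \<exists>U e. P \<in> U \<and> frame X F U e)"

definition H0 ::
  "('k::field, 'n::finite) point set \<Rightarrow> ('k, 'n) fun_sheaf \<Rightarrow> (('k, 'n) point \<Rightarrow> 'k) set" where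
  "H0 X F = F X"

definition h0 :: "('k::field, 'n::finite) point set \<Rightarrow> ('k, 'n) fun_sheaf \<Rightarrow> nat" where
  "h0 X F = fun_vs.dim (H0 X F)"

text \<open>The image sheaf of the evaluation map from \<open>W \<otimes> \<O>\<^sub>X\<close>, for a space \<open>W\<close> of global sections.\<close>

definition generated_sheaf ::
  "('k::field, 'n::finite) point set \<Rightarrow> (('k, 'n) point \<Rightarrow> 'k) set \<Rightarrow> ('k, 'n) fun_sheaf" where
  "generated_sheaf X W U = {s. supported_on U s \<and>
     (\<forall>P\<in>U. \<exists>V. openin (zar X) V \<and> P \<in> V \<and> V \<subseteq> U \<and>
        (\<exists>(n::nat) f w. (\<forall>i<n. f i \<in> struct_sheaf X V \<and> w i \<in> W) \<and>
           (\<forall>Q\<in>V. s Q = (\<Sum>i<n. f i Q * w i Q))))}"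

definition globally_generated ::
  "('k::field, 'n::finite) point set \<Rightarrow> ('k, 'n) fun_sheaf \<Rightarrow> bool" where
  "globally_generated X F \<longleftrightarrow>
     (\<forall>U. openin (zar X) U \<longrightarrow> generated_sheaf X (H0 X F) U = F U)"

text \<open>
  The tensor product of two line bundles on an irreducible variety: since the products of local
  generators are generically nonzero, the multiplication map from the sheaf tensor product to the
  sheaf of functions is injective, and its image is the sheaf of local sums of products.
\<close>

definition tensor_sheaf ::
  "('k::field, 'n::finite) point set \<Rightarrow> ('k, 'n) fun_sheaf \<Rightarrow> ('k, 'n) fun_sheaf \<Rightarrow>
     ('k, 'n) fun_sheaf" where
  "tensor_sheaf X F G U = {s. supported_on U s \<and>
     (\<forall>P\<in>U. \<exists>V. openin (zar X) V \<and> P \<in> V \<and> V \<subseteq> U \<and>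
        (\<exists>(n::nat) a b. (\<forall>i<n. a i \<in> F V \<and> b i \<in> G V) \<and>
           (\<forall>Q\<in>V. s Q = (\<Sum>i<n. a i Q * b i Q))))}"

definition uniformizer ::
  "('k::field, 'n::finite) point set \<Rightarrow> ('k, 'n) point \<Rightarrow> (('k, 'n) point \<Rightarrow> 'k) \<Rightarrow> bool" where
  "uniformizer C P t \<longleftrightarrow> t \<in> max_ideal C P \<and>
     (\<forall>f\<in>max_ideal C P. \<exists>g\<in>local_ring C P. eq_near C P f (g * t))"

definition rational_section ::
  "('k::field, 'n::finite) point set \<Rightarrow> ('k, 'n) fun_sheaf \<Rightarrow> (('k, 'n) point \<Rightarrow> 'k) \<Rightarrow> bool" where
  "rational_section X F s \<longleftrightarrow> (\<exists>U. openin (zar X) U \<and> U \<noteq> {} \<and> restr U s \<in> F U)"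

definition has_order ::
  "('k::field, 'n::finite) point set \<Rightarrow> ('k, 'n) fun_sheaf \<Rightarrow> ('k, 'n) point \<Rightarrow>
     (('k, 'n) point \<Rightarrow> 'k) \<Rightarrow> int \<Rightarrow> bool" where
  "has_order C F P s n \<longleftrightarrow> (\<exists>U e t u. P \<in> U \<and> frame C F U e \<and> uniformizer C P t \<and>
     u \<in> local_ring C P \<and> u P \<noteq> 0 \<and> eq_generic C s (\<lambda>Q. u Q * t Q powi n * e Q))"

text \<open>
  The degree of a line bundle on a smooth projective curve is the degree of the divisor of a
  nonzero rational section. Every line bundle has exactly one degree, since principal divisors have
  degree 0.
\<close>

definition has_degree ::
  "('k::field, 'n::finite) point set \<Rightarrow> ('k, 'n) fun_sheaf \<Rightarrow> int \<Rightarrow> bool" where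
  "has_degree C F d \<longleftrightarrow> (\<exists>s N. rational_section C F s \<and> \<not> eq_generic C s (\<lambda>_. 0) \<and>
     (\<forall>P\<in>C. has_order C F P s (N P)) \<and> finite {P \<in> C. N P \<noteq> 0} \<and>
     d = (\<Sum>P | P \<in> C \<and> N P \<noteq> 0. N P))"

definition linearly_semistable ::
  "('k::field, 'n::finite) point set \<Rightarrow> ('k, 'n) fun_sheaf \<Rightarrow> bool" where
  "linearly_semistable C L \<longleftrightarrow> (\<forall>r d. h0 C L = r + 1 \<and> has_degree C L d \<longrightarrow>
     (\<forall>W w d'. fun_vs.subspace W \<and> W \<subseteq> H0 C L \<and> fun_vs.dim W = w \<and> w \<ge> 2 \<and>
        has_degree C (generated_sheaf C W) d' \<longrightarrow>
        real_of_int d' / (real w - 1) \<ge> real_of_int d / real r))"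


section \<open>Tensor products and the multiplication map\<close>

text \<open>
  The tensor product of two spaces of functions is constructed as the free vector space on
  \<open>V \<times> W\<close> modulo the bilinearity relations; its elements are cosets.
\<close>

definition free_space :: "'a set \<Rightarrow> ('a \<Rightarrow> 'k::zero) set" where
  "free_space A = {c. finite {x. c x \<noteq> 0} \<and> supported_on A c}"

definition pure :: "'a \<Rightarrow> 'b \<Rightarrow> 'a \<times> 'b \<Rightarrow> 'k::zero_neq_one" where
  "pure v w = (\<lambda>x. if x = (v, w) then 1 else 0)"

definition bilinear_relations ::
  "('a \<Rightarrow> 'k::field) set \<Rightarrow> ('b \<Rightarrow> 'k) set \<Rightarrow> (('a \<Rightarrow> 'k) \<times> ('b \<Rightarrow> 'k) \<Rightarrow> 'k) set" where
  "bilinear_relations V W = fun_vs.span (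
     {pure (v + v') w - pure v w - pure v' w | v v' w. v \<in> V \<and> v' \<in> V \<and> w \<in> W} \<union>
     {pure v (w + w') - pure v w - pure v w' | v w w'. v \<in> V \<and> w \<in> W \<and> w' \<in> W} \<union>
     {pure (fscale a v) w - fscale a (pure v w) | a v w. v \<in> V \<and> w \<in> W} \<union>
     {pure v (fscale a w) - fscale a (pure v w) | a v w. v \<in> V \<and> w \<in> W})"

definition tensor_space ::
  "('a \<Rightarrow> 'k::field) set \<Rightarrow> ('b \<Rightarrow> 'k) set \<Rightarrow> (('a \<Rightarrow> 'k) \<times> ('b \<Rightarrow> 'k) \<Rightarrow> 'k) set set" where
  "tensor_space V W =
     {{c' \<in> free_space (V \<times> W). c' - c \<in> bilinear_relations V W} | c. c \<in> free_space (V \<times> W)}"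

text \<open>
  The multiplication map sends the class \<open>T\<close> of \<open>\<Sum> c\<^sub>i (s\<^sub>i, t\<^sub>i)\<close> to the section
  \<open>\<Sum> c\<^sub>i s\<^sub>i t\<^sub>i\<close> of the tensor product; this does not depend on the representative.
\<close>

definition mult_map ::
  "('k::field, 'n::finite) point set \<Rightarrow> ('k, 'n) fun_sheaf \<Rightarrow> ('k, 'n) fun_sheaf \<Rightarrow>
     ((('k, 'n) point \<Rightarrow> 'k) \<times> (('k, 'n) point \<Rightarrow> 'k) \<Rightarrow> 'k) set \<Rightarrow> (('k, 'n) point \<Rightarrow> 'k)" where
  "mult_map X F G T = (THE u. u \<in> H0 X (tensor_sheaf X F G) \<and>
     (\<exists>c\<in>T. u = (\<Sum>x | c x \<noteq> 0. fscale (c x) (fst x * snd x))))"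

end

theory Submission
  imports Defs
begin

text \<open>
  A nonzero element of the kernel of the multiplication map has the form \<open>a \<otimes> \<sigma> + b \<otimes> \<rho>\<close> with \<open>\<sigma>, \<rho>\<close> a
  basis of \<open>H\<^sup>0(B)\<close> and \<open>a \<sigma> + b \<rho> = 0\<close>. Multiplication by \<open>a / \<rho> = - b / \<sigma>\<close> identifies the subsheaf of
  \<open>B\<close> generated by \<open>\<sigma>, \<rho>\<close> with the subsheaf of \<open>L\<close> generated by the pencil \<open>W = \<langle>a, b\<rangle>\<close>, so the latter
  has degree at most \<open>\<gamma> < d / r\<close> and \<open>W\<close> destabilises \<open>L\<close>. Computing this degree with the sections at
  hand requires that regular functions have finite order at a point (Krull's intersection theorem)
  and that a nonempty open subset of the curve is cofinite; both come from Hilbert's basis theorem.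
\<close>

section \<open>Noetherian rings of functions\<close>

text \<open>Semistability is tested against every integer that \<open>has_degree\<close> assigns to
  the generated sheaf, so one such integer at most \<open>\<gamma>\<close> is to be exhibited. It
  comes from the data behind the degree of \<open>B\<close>: a rational section \<open>s\<close>
  with orders \<open>N P\<close>. The section \<open>(a / \<rho>) s\<close> has order
  \<open>N P - m P\<close> in the sheaf generated by \<open>W\<close>, where \<open>m P\<close> is
  the smaller of the orders of \<open>\<sigma>\<close> and \<open>\<rho>\<close> at
  \<open>P\<close>. The base divisor of \<open>\<sigma>, \<rho>\<close> is subtracted, which
  explains why the degree can only drop. An obstacle shapes the local arguments: a frame is nonzero
  only generically, so an identity of sections cannot be divided by a frame at a given point.
  Coefficients are compared generically, and the comparison is carried to the point by the identity
  principle for regular functions.\<close>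

definition is_subring :: "'a::comm_ring_1 set \<Rightarrow> bool" where
  "is_subring R \<longleftrightarrow> 1 \<in> R \<and> (\<forall>x\<in>R. \<forall>y\<in>R. x - y \<in> R \<and> x * y \<in> R)"

lemma is_subringD:
  assumes "is_subring R"
  shows "0 \<in> R" "1 \<in> R" "x \<in> R \<Longrightarrow> y \<in> R \<Longrightarrow> x - y \<in> R" "x \<in> R \<Longrightarrow> y \<in> R \<Longrightarrow> x * y \<in> R"
    "x \<in> R \<Longrightarrow> y \<in> R \<Longrightarrow> x + y \<in> R"
proof -
  show one: "1 \<in> R" and diff: "x \<in> R \<Longrightarrow> y \<in> R \<Longrightarrow> x - y \<in> R"
    and "x \<in> R \<Longrightarrow> y \<in> R \<Longrightarrow> x * y \<in> R" for x y
    using assms unfolding is_subring_def by auto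
  show zero: "0 \<in> R" using diff[OF one one] by simp
  show "x \<in> R \<Longrightarrow> y \<in> R \<Longrightarrow> x + y \<in> R" for x y
    using diff[of x "0 - y"] diff[OF zero, of y] by simp
qed

lemma is_subring_sum:
  assumes "is_subring R" "\<And>i. i \<in> A \<Longrightarrow> f i \<in> R"
  shows "sum f A \<in> R"
  using assms(2) by (induction A rule: infinite_finite_induct) (auto intro: is_subringD[OF assms(1)])

lemma is_subring_power:
  assumes "is_subring R" "x \<in> R"
  shows "x ^ n \<in> R"
  by (induction n) (auto intro: is_subringD[OF assms(1)] assms(2))

section \<open>Ideals spanned by the initial entries of a sequence\<close>

definition combinations :: "'a::comm_ring_1 set \<Rightarrow> nat \<Rightarrow> (nat \<Rightarrow> 'a) \<Rightarrow> 'a set" where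
  "combinations R n a = {\<Sum>i<n. c i * a i | c. \<forall>i<n. c i \<in> R}"

lemma combinations_add:
  assumes "is_subring R" "x \<in> combinations R n a" "y \<in> combinations R n a"
  shows "x + y \<in> combinations R n a"
proof -
  obtain c e where "\<forall>i<n. c i \<in> R" "x = (\<Sum>i<n. c i * a i)" "\<forall>i<n. e i \<in> R" "y = (\<Sum>i<n. e i * a i)"
    using assms(2,3) unfolding combinations_def by auto
  then show ?thesis unfolding combinations_def
    by (auto intro!: exI[of _ "\<lambda>i. c i + e i"] simp: algebra_simps sum.distrib is_subringD[OF assms(1)])
qed

lemma combinations_mult:
  assumes "is_subring R" "r \<in> R" "x \<in> combinations R n a"
  shows "r * x \<in> combinations R n a"
proof -
  obtain c where "\<forall>i<n. c i \<in> R" "x = (\<Sum>i<n. c i * a i)"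
    using assms(3) unfolding combinations_def by auto
  then show ?thesis unfolding combinations_def
    by (auto intro!: exI[of _ "\<lambda>i. r * c i"] simp: sum_distrib_left mult.assoc is_subringD[OF assms(1)] assms(2))
qed

lemma combinations_base:
  assumes "is_subring R" "i < n"
  shows "a i \<in> combinations R n a"
proof -
  have "a i = (\<Sum>j<n. (if j = i then 1 else 0) * a j)"
    using assms(2) by (simp add: if_distrib[of "\<lambda>x. x * _"] sum.delta cong: if_cong)
  then show ?thesis unfolding combinations_def
    by (auto intro!: exI[of _ "\<lambda>j. if j = i then 1 else 0"] simp: is_subringD[OF assms(1)])
qed

lemma combinations_zero:
  assumes "is_subring R"
  shows "0 \<in> combinations R n a"
  unfolding combinations_def by (auto intro!: exI[of _ "\<lambda>_. 0"] simp: is_subringD[OF assms])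

lemma combinations_sum:
  assumes "is_subring R" "\<And>i. i \<in> A \<Longrightarrow> x i \<in> combinations R n a"
  shows "sum x A \<in> combinations R n a"
  using assms(2) by (induction A rule: infinite_finite_induct)
    (auto intro: combinations_add combinations_zero assms(1))

lemma combinations_trans:
  assumes "is_subring R" "\<And>i. i < m \<Longrightarrow> b i \<in> combinations R n a" "x \<in> combinations R m b"
  shows "x \<in> combinations R n a"
  using assms(3) unfolding combinations_def[of R m]
  by (auto intro!: combinations_sum combinations_mult assms(1,2))

lemma combinations_mono:
  assumes "is_subring R" "m \<le> n" "x \<in> combinations R m a"
  shows "x \<in> combinations R n a"
  by (rule combinations_trans[OF assms(1) _ assms(3)]) (use assms combinations_base in force)

text \<open>The chain condition for the ideals generated by initial segments, in the form in which
  it is applied to a sequence of numerators or of vanishing forms. The case \<open>N = 0\<close>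
  says \<open>a 0 = 0\<close>, as the empty combination is 0.\<close>

definition noetherian :: "'a::comm_ring_1 set \<Rightarrow> bool" where
  "noetherian R \<longleftrightarrow> (\<forall>a. (\<forall>i::nat. a i \<in> R) \<longrightarrow> (\<exists>N. a N \<in> combinations R N a))"

definition polys_over :: "'a::comm_ring_1 set \<Rightarrow> 'a poly set" where
  "polys_over R = {p. \<forall>i. coeff p i \<in> R}"

text \<open>The ring \<open>R[h]\<close> is taken as the image of \<open>R[X]\<close> inside the
  ambient ring, so that iterated adjunction stays in one type.\<close>

definition adjoin :: "'a::comm_ring_1 set \<Rightarrow> 'a \<Rightarrow> 'a set" where
  "adjoin R h = (\<lambda>p. poly p h) ` polys_over R"

lemma is_subring_polys_over:
  assumes "is_subring R"
  shows "is_subring (polys_over R)"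
  unfolding is_subring_def polys_over_def
  by (auto simp: coeff_mult coeff_1 is_subringD[OF assms] intro!: is_subring_sum[OF assms])

lemma monom_in_polys_over: "is_subring R \<Longrightarrow> c \<in> R \<Longrightarrow> monom c n \<in> polys_over R"
  by (auto simp: polys_over_def is_subringD)

lemma is_subring_adjoin:
  assumes "is_subring R"
  shows "is_subring (adjoin R h)"
proof -
  note P = is_subringD[OF is_subring_polys_over[OF assms]]
  have "1 \<in> adjoin R h" unfolding adjoin_def by (rule image_eqI[of _ _ 1]) (auto simp: P)
  moreover have "poly p h - poly q h \<in> adjoin R h" "poly p h * poly q h \<in> adjoin R h"
    if "p \<in> polys_over R" "q \<in> polys_over R" for p q
    unfolding adjoin_def using P that by (metis image_eqI poly_diff, metis image_eqI poly_mult)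
  ultimately show ?thesis unfolding is_subring_def by (auto simp: adjoin_def)
qed

lemma subset_adjoin: "is_subring R \<Longrightarrow> R \<subseteq> adjoin R h"
  unfolding adjoin_def by (auto intro!: image_eqI[of _ _ "monom _ 0"] monom_in_polys_over simp: poly_monom)

lemma adjoined_in_adjoin: "is_subring R \<Longrightarrow> h \<in> adjoin R h"
  unfolding adjoin_def by (auto intro!: image_eqI[of _ _ "monom 1 1"] monom_in_polys_over
    simp: poly_monom is_subringD)

lemma adjoin_subset:
  assumes "is_subring S" "R \<subseteq> S" "h \<in> S"
  shows "adjoin R h \<subseteq> S"
proof
  fix x assume "x \<in> adjoin R h"
  then obtain p where p: "\<And>i. coeff p i \<in> R" "x = poly p h"
    unfolding adjoin_def polys_over_def by auto
  then show "x \<in> S" using assms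
    by (auto simp: poly_altdef intro!: is_subring_sum is_subringD(4) is_subring_power)
qed

text \<open>
  Hilbert's basis theorem. As \<open>h\<close> may be algebraic over \<open>R\<close>, the leading terms are taken in the
  preimages under \<open>R[X] \<rightarrow> R[h]\<close> of the ideals in question.
\<close>

theorem noetherian_adjoin:
  fixes R :: "'a::comm_ring_1 set"
  assumes R: "is_subring R" and N: "noetherian R"
  shows "noetherian (adjoin R h)"
  unfolding noetherian_def
proof (intro allI impI, rule ccontr)
  fix a :: "nat \<Rightarrow> 'a" assume a: "\<forall>i. a i \<in> adjoin R h"
    and no: "\<nexists>N. a N \<in> combinations (adjoin R h) N a"
  define S where "S = adjoin R h"
  define P where "P = polys_over R"
  have S: "is_subring S" and P: "is_subring P"
    unfolding S_def P_def using R is_subring_adjoin is_subring_polys_over by auto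
  have PS: "poly p h \<in> S" if "p \<in> P" for p using that unfolding S_def P_def adjoin_def by auto
  \<comment> \<open>\<open>J\<close> is the preimage in \<open>R[X]\<close> of the ideal generated
    by all \<open>a i\<close>; each member needs only some initial segment.\<close>
  define J where "J = {p \<in> P. \<exists>n. poly p h \<in> combinations S n a}"
  have J_add: "p + q \<in> J" if pq: "p \<in> J" "q \<in> J" for p q
  proof -
    obtain n m where "poly p h \<in> combinations S n a" "poly q h \<in> combinations S m a"
      using pq unfolding J_def by auto
    then have "poly (p + q) h \<in> combinations S (max n m) a"
      by (auto intro!: combinations_add[OF S]
        intro: combinations_mono[OF S max.cobounded1] combinations_mono[OF S max.cobounded2])
    then show ?thesis using that is_subringD(5)[OF P] unfolding J_def by blast
  qed
  have J_mult: "r * p \<in> J" if "p \<in> J" "r \<in> P" for r p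
    using that combinations_mult[OF S PS] is_subringD(4)[OF P] unfolding J_def by fastforce
  have J_zero: "0 \<in> J" unfolding J_def using combinations_zero[OF S] is_subringD(1)[OF P] by auto
  have J_sum: "sum f A \<in> J" if "\<And>i. i \<in> A \<Longrightarrow> f i \<in> J" for f and A :: "nat set"
    using that by (induction A rule: infinite_finite_induct) (auto intro: J_zero J_add)
  \<comment> \<open>If \<open>f 0, ..., f (n - 1)\<close> generated \<open>J\<close>, their values
    at \<open>h\<close> would lie in the ideal of a single initial segment
    \<open>a 0, ..., a (M - 1)\<close>, and so would \<open>a M\<close>, which is itself the value
    of an element of \<open>J\<close>.\<close>
  have not_fg: "\<exists>p. p \<in> J \<and> p \<notin> combinations P n f" if f: "\<forall>i<n. f i \<in> J" for n f
  proof -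
    have "\<exists>M. \<forall>i<n. poly (f i) h \<in> combinations S M a"
      using f
    proof (induction n)
      case (Suc n)
      then obtain M where M: "\<forall>i<n. poly (f i) h \<in> combinations S M a" by auto
      obtain m where m: "poly (f n) h \<in> combinations S m a" using Suc.prems unfolding J_def by auto
      have "\<forall>i<Suc n. poly (f i) h \<in> combinations S (max M m) a"
        using M m combinations_mono[OF S] less_Suc_eq by (metis max.cobounded1 max.cobounded2)
      then show ?case by blast
    qed simp
    then obtain M where M: "\<forall>i<n. poly (f i) h \<in> combinations S M a" by auto
    obtain p where p: "p \<in> P" "a M = poly p h" using a unfolding P_def adjoin_def by blast
    have "poly p h \<in> combinations S (Suc M) a" unfolding p(2)[symmetric] by (rule combinations_base[OF S]) simp
    then have "p \<in> J" using p unfolding J_def by auto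
    moreover have "p \<notin> combinations P n f"
    proof
      assume "p \<in> combinations P n f"
      then obtain c where c: "\<forall>i<n. c i \<in> P" "p = (\<Sum>i<n. c i * f i)" unfolding combinations_def by auto
      have "a M \<in> combinations S M a" unfolding p(2) c(2) poly_sum poly_mult
        by (rule combinations_sum[OF S], rule combinations_mult[OF S PS]) (use c(1) M in auto)
      then show False using no unfolding S_def by blast
    qed
    ultimately show ?thesis by blast
  qed
  \<comment> \<open>\<open>f n\<close> will be an element of least degree in \<open>J\<close>
    outside the ideal of its predecessors.\<close>
  define Q where "Q f n p \<longleftrightarrow> p \<in> J \<and> p \<notin> combinations P n f \<and>
     (\<forall>q\<in>J. q \<notin> combinations P n f \<longrightarrow> degree p \<le> degree q)" for f n p
  have "\<exists>f. \<forall>n. Q f n (f n)"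
  proof (rule dependent_wellorder_choice)
    fix r and f g :: "nat \<Rightarrow> 'a poly" and n
    assume "\<And>y. y < n \<Longrightarrow> f y = g y"
    then have "combinations P n f = combinations P n g" unfolding combinations_def
      by (intro Collect_cong ex_cong1 conj_cong refl arg_cong2[where f="(=)"] sum.cong) auto
    then show "Q f n r = Q g n r" unfolding Q_def by simp
  next
    fix n and f :: "nat \<Rightarrow> 'a poly"
    assume "\<And>y. y < n \<Longrightarrow> Q f y (f y)"
    then have "\<forall>i<n. f i \<in> J" unfolding Q_def by auto
    from not_fg[OF this] have "\<exists>p. p \<in> J \<and> p \<notin> combinations P n f" .
    then show "\<exists>r. Q f n r" unfolding Q_def
      using ex_has_least_nat[of "\<lambda>p. p \<in> J \<and> p \<notin> combinations P n f" _ degree] by blast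
  qed
  then obtain f where f: "\<And>n. Q f n (f n)" by blast
  have fJ: "f n \<in> J" and fn: "f n \<notin> combinations P n f"
    and fmin: "\<And>q. q \<in> J \<Longrightarrow> q \<notin> combinations P n f \<Longrightarrow> degree (f n) \<le> degree q" for n
    using f unfolding Q_def by blast+
  have "\<forall>i. lead_coeff (f i) \<in> R" using fJ unfolding J_def P_def polys_over_def by auto
  then obtain n where "lead_coeff (f n) \<in> combinations R n (\<lambda>i. lead_coeff (f i))"
    using N[unfolded noetherian_def, rule_format, of "\<lambda>i. lead_coeff (f i)"] by blast
  then obtain c where c: "\<forall>i<n. c i \<in> R" "lead_coeff (f n) = (\<Sum>i<n. c i * lead_coeff (f i))"
    unfolding combinations_def by auto
  have deg: "degree (f i) \<le> degree (f n)" if "i < n" for i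
    using fmin[OF fJ, of n i] fn combinations_mono[OF P less_imp_le[OF that]] by blast
  \<comment> \<open>The monomial lifts \<open>f i\<close> to the degree of \<open>f n\<close>, so
    that \<open>s\<close> and \<open>f n\<close> have the same coefficient in that degree.\<close>
  define e where "e i = monom (c i) (degree (f n) - degree (f i))" for i
  have e: "e i \<in> P" if "i < n" for i using c that R unfolding e_def P_def by (auto intro: monom_in_polys_over)
  define s where "s = (\<Sum>i<n. e i * f i)"
  have s: "s \<in> combinations P n f" unfolding s_def combinations_def using e by blast
  have "s \<in> J" unfolding s_def using e fJ J_mult by (auto intro: J_sum)
  then have "f n - s \<in> J"
    using J_add[OF fJ J_mult[of s "0 - 1"]] is_subringD[OF P] by fastforce
  moreover have q: "f n - s \<notin> combinations P n f"
    using combinations_add[OF P _ s, of "f n - s"] fn by auto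
  ultimately have le: "degree (f n) \<le> degree (f n - s)" by (rule fmin)
  have ds: "degree s \<le> degree (f n)" unfolding s_def
  proof (rule degree_sum_le)
    fix i assume "i \<in> {..<n}"
    then show "degree (e i * f i) \<le> degree (f n)"
      using degree_mult_le[of "e i" "f i"] degree_monom_le[of "c i" "degree (f n) - degree (f i)"] deg[of i]
      unfolding e_def by auto
  qed simp
  have "coeff (f n - s) (degree (f n)) = 0"
  proof -
    have "coeff (e i * f i) (degree (f n)) = c i * lead_coeff (f i)" if "i < n" for i
      using deg[OF that] by (simp add: e_def coeff_monom_mult)
    then show ?thesis unfolding s_def c(2) coeff_diff coeff_sum by (simp add: c(2)[symmetric])
  qed
  moreover have "degree (f n - s) = degree (f n)" using le degree_diff_le[OF order_refl ds] by simp
  \<comment> \<open>Minimality forces the difference to keep the degree of \<open>f n\<close>,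
    although its coefficient there is 0. Hence it is 0, which lies in every ideal.\<close>
  ultimately have "f n - s = 0" by (metis leading_coeff_0_iff)
  then show False using q combinations_zero[OF P] by simp
qed

lemma foldr_adjoin:
  assumes "is_subring R"
  shows "is_subring (foldr (\<lambda>h S. adjoin S h) hs R)"
    and "R \<subseteq> foldr (\<lambda>h S. adjoin S h) hs R"
    and "set hs \<subseteq> foldr (\<lambda>h S. adjoin S h) hs R"
    and "noetherian R \<Longrightarrow> noetherian (foldr (\<lambda>h S. adjoin S h) hs R)"
    and "is_subring S \<Longrightarrow> R \<subseteq> S \<Longrightarrow> set hs \<subseteq> S \<Longrightarrow> foldr (\<lambda>h S. adjoin S h) hs R \<subseteq> S"
proof -
  show *: "is_subring (foldr (\<lambda>h S. adjoin S h) hs R)" for hs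
    by (induction hs) (auto intro: is_subring_adjoin assms)
  show "R \<subseteq> foldr (\<lambda>h S. adjoin S h) hs R"
    by (induction hs) (use subset_adjoin[OF *] in auto)
  show "set hs \<subseteq> foldr (\<lambda>h S. adjoin S h) hs R"
    by (induction hs) (use subset_adjoin[OF *] adjoined_in_adjoin[OF *] in auto)
  show "noetherian R \<Longrightarrow> noetherian (foldr (\<lambda>h S. adjoin S h) hs R)"
    by (induction hs) (auto intro: noetherian_adjoin *)
  show "is_subring S \<Longrightarrow> R \<subseteq> S \<Longrightarrow> set hs \<subseteq> S \<Longrightarrow> foldr (\<lambda>h S. adjoin S h) hs R \<subseteq> S"
  proof (induction hs)
    case (Cons h hs)
    then show ?case using adjoin_subset[of S _ h] by simp
  qed simp
qed

section \<open>The ring of polynomial functions\<close>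

inductive_set poly_funs :: "('k::field ^ 'n::finite \<Rightarrow> 'k) set" where
  const: "(\<lambda>v. a) \<in> poly_funs"
| coord: "(\<lambda>v. v $ i) \<in> poly_funs"
| diff: "F \<in> poly_funs \<Longrightarrow> G \<in> poly_funs \<Longrightarrow> F - G \<in> poly_funs"
| mult: "F \<in> poly_funs \<Longrightarrow> G \<in> poly_funs \<Longrightarrow> F * G \<in> poly_funs"

lemma is_subring_poly_funs: "is_subring poly_funs"
  unfolding is_subring_def using poly_funs.const[of 1] by (auto intro: poly_funs.intros simp: one_fun_def)

lemma hom_poly_in_poly_funs: "hom_poly m F \<Longrightarrow> F \<in> poly_funs"
proof (induction rule: hom_poly.induct)
  case (add m F G)
  then show ?case using is_subringD(5)[OF is_subring_poly_funs, of F G] by (simp add: plus_fun_def)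
next
  case (mult l F m G)
  then show ?case using poly_funs.mult[of F G] by (simp add: times_fun_def)
qed (auto intro: poly_funs.intros)

text \<open>Polynomial functions arise from the constants by adjoining the finitely many coordinate
  functions, so the basis theorem is iterated.\<close>

theorem noetherian_poly_funs: "noetherian (poly_funs :: ('k::field ^ 'n::finite \<Rightarrow> 'k) set)"
proof -
  define K :: "('k ^ 'n \<Rightarrow> 'k) set" where "K = range (\<lambda>a v. a)"
  have Ks: "is_subring K" unfolding is_subring_def K_def
    by (auto simp: one_fun_def image_iff fun_eq_iff)
  have Kn: "noetherian K" unfolding noetherian_def
  proof (intro allI impI)
    fix a :: "nat \<Rightarrow> 'k ^ 'n \<Rightarrow> 'k" assume "\<forall>i. a i \<in> K"
    then obtain c where c: "\<And>i v. a i v = c i" unfolding K_def image_iff by metis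
    \<comment> \<open>A field has only two ideals: \<open>N = 0\<close> serves if the first entry is
      zero, and otherwise the second entry is a multiple of the first.\<close>
    show "\<exists>N. a N \<in> combinations K N a"
    proof (cases "c 0 = 0")
      case True
      then have "a 0 = 0" using c by (auto simp: fun_eq_iff)
      then show ?thesis using combinations_zero[OF Ks, of 0 a] by (intro exI[of _ 0]) simp
    next
      case False
      have "a 1 = (\<lambda>v. c 1 / c 0) * a 0" using c False by (auto simp: fun_eq_iff)
      moreover have "(\<lambda>v. c 1 / c 0) * a 0 \<in> combinations K 1 a"
        by (rule combinations_mult[OF Ks], simp add: K_def, rule combinations_base[OF Ks], simp)
      ultimately show ?thesis by metis
    qed
  qed
  obtain js :: "'n list" where js: "set js = UNIV" using finite_list[OF finite] by blast
  define hs where "hs = map (\<lambda>i (v :: 'k ^ 'n). v $ i) js"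
  note F = foldr_adjoin[OF Ks, where hs = hs]
  have "foldr (\<lambda>h S. adjoin S h) hs K = poly_funs" (is "?S = _")
  proof
    show "?S \<subseteq> poly_funs"
      by (rule F(5)) (auto simp: is_subring_poly_funs K_def hs_def intro: poly_funs.intros)
    show "poly_funs \<subseteq> ?S"
    proof
      fix x assume "x \<in> (poly_funs :: ('k ^ 'n \<Rightarrow> 'k) set)"
      then show "x \<in> ?S"
      proof induction
        case (const a)
        then show ?case using F(2) unfolding K_def by auto
      next
        case (coord i)
        then show ?case using F(3) js unfolding hs_def by auto
      next
        case (diff F G)
        then show ?case using is_subringD(3)[OF F(1)] by blast
      next
        case (mult F G)
        then show ?case using is_subringD(4)[OF F(1)] by blast
      qed
    qed
  qed
  then show ?thesis using F(4)[OF Kn] by simp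
qed

section \<open>Regular functions on an irreducible variety\<close>

lemma sum_apply: "sum f A x = (\<Sum>i\<in>A. f i x)"
  by (induction A rule: infinite_finite_induct) auto

section \<open>Closed points, basic open sets and descending chains in projective space\<close>

lemma proj_space_line:
  assumes "Q \<in> proj_space" "v \<in> Q" "v \<noteq> 0" "w \<in> Q"
  shows "\<exists>c. w = c *s v"
proof -
  obtain u where u: "Q = vec.span {u}" using assms(1) unfolding proj_space_def by auto
  obtain a b where ab: "v = a *s u" "w = b *s u"
    using assms(2,4) unfolding u by (auto simp: vec.span_singleton)
  have "a \<noteq> 0" using ab assms(3) by auto
  then have "w = (b / a) *s v" using ab by (simp add: vector_smult_assoc)
  then show ?thesis by blast
qed

lemma proj_space_nonzero: "Q \<in> proj_space \<Longrightarrow> \<exists>v. v \<in> Q \<and> v \<noteq> 0"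
  unfolding proj_space_def by (auto intro: vec.span_base)

lemma hom_poly_vanish_line:
  assumes "Q \<in> proj_space" "hom_poly m G" "v \<in> Q" "v \<noteq> 0" "G v = 0" "w \<in> Q"
  shows "G w = 0"
  using proj_space_line[OF assms(1,3,4,6)] hom_poly_scale[OF assms(2)] assms(5) by (metis mult_zero_right)

text \<open>This is the basic open set of \<open>G\<close>. By homogeneity the values at the nonzero
  vectors of a line are all zero or all nonzero, so it is the complement of
  \<open>zero_locus {G}\<close> in \<open>X\<close>.\<close>

lemma openin_nonvanishing:
  assumes "hom_poly m G" "X \<subseteq> proj_space"
  shows "openin (zar X) {Q \<in> X. \<forall>v\<in>Q. v \<noteq> 0 \<longrightarrow> G v \<noteq> 0}"
proof -
  have "algebraic_set (zero_locus {G})" unfolding algebraic_set_def using assms by blast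
  moreover have "proj_space - (proj_space - zero_locus {G}) = zero_locus {G}"
    unfolding zero_locus_def by blast
  ultimately have "algebraic_set (proj_space - (proj_space - zero_locus {G}))" by (simp only:)
  then have o: "openin zariski (proj_space - zero_locus {G})"
    by (subst openin_zariski) (rule conjI[OF Diff_subset])
  have "{Q \<in> X. \<forall>v\<in>Q. v \<noteq> 0 \<longrightarrow> G v \<noteq> 0} = X \<inter> (proj_space - zero_locus {G})"
  proof -
    have "(\<forall>v\<in>Q. v \<noteq> 0 \<longrightarrow> G v \<noteq> 0) \<longleftrightarrow> Q \<notin> zero_locus {G}" if "Q \<in> X" for Q
    proof -
      have Q: "Q \<in> proj_space" using assms(2) that by (rule subsetD)
      obtain v where v: "v \<in> Q" "v \<noteq> 0" using proj_space_nonzero[OF Q] by (elim exE conjE)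
      have "Q \<in> zero_locus {G} \<longleftrightarrow> (\<forall>v\<in>Q. G v = 0)" unfolding zero_locus_def using Q by simp
      then show ?thesis using hom_poly_vanish_line[OF Q assms(1)] v by metis
    qed
    then show ?thesis using assms(2) by auto
  qed
  then show ?thesis using openin_subtopology_Int2[OF o, of X] by simp
qed

text \<open>The linear form is a two by two minor of the matrix with columns \<open>u\<close> and
  \<open>v\<close>; for \<open>u \<noteq> 0\<close> these minors all vanish exactly when
  \<open>v\<close> lies on the line of \<open>u\<close>.\<close>

lemma hom_poly_minor:
  fixes i j :: "'n::finite" and u :: "'k::field ^ 'n"
  shows "hom_poly 1 (\<lambda>v. u $ i * v $ j + (- u $ j) * v $ i)"
proof -
  have "hom_poly 1 (\<lambda>v. c * v $ j)" for c :: 'k and j :: 'n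
    using hom_poly.mult[OF hom_poly.const[of c] hom_poly.coord[of j]] by (simp only: add_0)
  then show ?thesis by (intro hom_poly.add)
qed

lemma closedin_zariski_point:
  assumes "P \<in> proj_space"
  shows "closedin zariski {P}"
proof -
  obtain u where u: "P = vec.span {u}" "u \<noteq> 0" using assms unfolding proj_space_def by auto
  then obtain i where i: "u $ i \<noteq> 0" by (metis vec_eq_iff zero_index)
  \<comment> \<open>Since \<open>u $ i \<noteq> 0\<close>, the minors that involve the index
    \<open>i\<close> already cut out the line of \<open>u\<close>.\<close>
  define T where "T = {(\<lambda>v. u $ i * v $ j + (- u $ j) * v $ i) | j. True}"
  have "{P} = zero_locus T"
  proof (intro equalityI subsetI)
    fix Q assume "Q \<in> {P}"
    then show "Q \<in> zero_locus T" using assms unfolding zero_locus_def T_def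
      by (auto simp: u(1) vec.span_singleton)
  next
    fix Q assume Q: "Q \<in> zero_locus T"
    then obtain v where v: "Q = vec.span {v}" "v \<noteq> 0" unfolding zero_locus_def proj_space_def by auto
    then have "v \<in> Q" by (simp add: vec.span_base)
    then have "u $ i * v $ j = u $ j * v $ i" for j
      using Q unfolding zero_locus_def T_def by force
    then have eq: "u $ i * v $ j = u $ j * v $ i" for j .
    then have vu: "v = (v $ i / u $ i) *s u" using i by (simp add: vec_eq_iff field_simps)
    then have vi: "v $ i \<noteq> 0" using v(2) by auto
    from vu have "v \<in> P" unfolding u(1) vec.span_singleton by (rule range_eqI)
    have "u = (u $ i / v $ i) *s v" using eq vi by (simp add: vec_eq_iff field_simps)
    then have "u \<in> Q" unfolding v(1) vec.span_singleton by (rule range_eqI)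
    have "vec.span {v} = vec.span {u}"
      using \<open>v \<in> P\<close> \<open>u \<in> Q\<close> unfolding u(1) v(1) by (simp add: vec.span_eq)
    then show "Q \<in> {P}" using u v by simp
  qed
  moreover have "\<forall>F\<in>T. \<exists>m. hom_poly m F" unfolding T_def using hom_poly_minor by blast
  ultimately show ?thesis unfolding closedin_zariski algebraic_set_def by blast
qed

text \<open>Along a strictly descending chain choose forms \<open>F i\<close> that vanish on
  \<open>Z (Suc i)\<close> but not on \<open>Z i\<close>. The chain condition writes some
  \<open>F N\<close> through its predecessors, all of which vanish on \<open>Z N\<close>: a
  contradiction.\<close>

lemma closedin_zariski_wf:
  "wf {(Y :: ('k::field, 'n::finite) point set, Z). closedin zariski Y \<and> closedin zariski Z \<and> Y \<subset> Z}"
  unfolding wf_iff_no_infinite_down_chain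
proof
  assume *: "\<exists>Z. \<forall>i. (Z (Suc i), Z i) \<in>
    {(Y :: ('k, 'n) point set, Z). closedin zariski Y \<and> closedin zariski Z \<and> Y \<subset> Z}"
  then obtain Z :: "nat \<Rightarrow> ('k, 'n) point set"
    where Z: "\<And>i. closedin zariski (Z i)" "\<And>i. Z (Suc i) \<subset> Z i"
  proof -
    from * obtain Z where "\<forall>i. (Z (Suc i), Z i) \<in>
      {(Y :: ('k, 'n) point set, Z). closedin zariski Y \<and> closedin zariski Z \<and> Y \<subset> Z}" ..
    then have "closedin zariski (Z i)" "Z (Suc i) \<subset> Z i" for i by auto
    then show thesis by (rule that)
  qed
  have "\<exists>F m. hom_poly m F \<and> (\<forall>P\<in>Z (Suc i). \<forall>v\<in>P. F v = 0) \<and> (\<exists>P\<in>Z i. \<exists>v\<in>P. F v \<noteq> 0)" for i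
  proof -
    obtain T where T: "\<forall>F\<in>T. \<exists>m. hom_poly m F" "Z (Suc i) = zero_locus T"
      using Z(1) unfolding closedin_zariski algebraic_set_def by blast
    obtain P where P: "P \<in> Z i" "P \<notin> Z (Suc i)" using Z(2) by blast
    then have "P \<in> proj_space" using closedin_subset[OF Z(1)] unfolding topspace_zariski by blast
    then obtain F v where "F \<in> T" "v \<in> P" "F v \<noteq> 0" using P(2) unfolding T(2) zero_locus_def by auto
    moreover have "\<forall>P\<in>Z (Suc i). \<forall>v\<in>P. F v = 0" using \<open>F \<in> T\<close> unfolding T(2) zero_locus_def by simp
    moreover obtain m where "hom_poly m F" using T(1) \<open>F \<in> T\<close> by auto
    ultimately show ?thesis using P(1) by (intro exI[of _ F] exI[of _ m] conjI bexI) auto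
  qed
  then obtain F where F: "\<And>i. \<exists>m. hom_poly m (F i)" "\<And>i. \<forall>P\<in>Z (Suc i). \<forall>v\<in>P. F i v = 0"
    "\<And>i. \<exists>P\<in>Z i. \<exists>v\<in>P. F i v \<noteq> 0" by metis
  have "\<forall>i. F i \<in> poly_funs" using F(1) hom_poly_in_poly_funs by blast
  then obtain N where "F N \<in> combinations poly_funs N F"
    using noetherian_poly_funs unfolding noetherian_def by blast
  then obtain c where c: "F N = (\<Sum>i<N. c i * F i)" unfolding combinations_def by blast
  have "decseq Z" by (rule decseq_SucI) (rule psubset_imp_subset[OF Z(2)])
  then have "Z N \<subseteq> Z (Suc i)" if "i < N" for i using that by (simp add: decseqD)
  then have "F N v = 0" if "P \<in> Z N" "v \<in> P" for P v
  proof -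
    have "F i v = 0" if "i < N" for i
      using F(2)[of i] \<open>\<And>i. i < N \<Longrightarrow> Z N \<subseteq> Z (Suc i)\<close>[OF that] \<open>P \<in> Z N\<close> \<open>v \<in> P\<close> by auto
    then show ?thesis unfolding c by (simp add: sum_apply)
  qed
  then show False using F(3) by blast
qed

section \<open>Germs and generic behaviour on an irreducible variety\<close>

locale irreducible_variety =
  fixes X :: "('k::field, 'n::finite) point set"
  assumes irreducible: "irreducible_closed zariski X"
begin

lemma closed: "closedin zariski X"
  using irreducible unfolding irreducible_closed_def by blast

lemma subset_proj_space: "X \<subseteq> proj_space"
  using closedin_subset[OF closed] unfolding topspace_zariski .

lemma point_nonzero: "Q \<in> X \<Longrightarrow> \<exists>v. v \<in> Q \<and> v \<noteq> 0"
  using proj_space_nonzero[of Q] subsetD[OF subset_proj_space, of Q] by simp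

lemma vanish_line: "Q \<in> X \<Longrightarrow> hom_poly m G \<Longrightarrow> v \<in> Q \<Longrightarrow> v \<noteq> 0 \<Longrightarrow> G v = 0 \<Longrightarrow> w \<in> Q \<Longrightarrow> G w = 0"
  using hom_poly_vanish_line subset_proj_space by (meson subsetD)

lemma topspace_X: "topspace (zar X) = X"
  using subset_proj_space by (auto simp: topspace_zariski)

lemma openin_X_subset: "openin (zar X) U \<Longrightarrow> U \<subseteq> X"
  using openin_subset topspace_X by metis

lemma openin_X: "openin (zar X) X"
  using openin_topspace[of "zar X"] unfolding topspace_X .

lemma closedin_zar: "closedin (zar X) Z \<longleftrightarrow> closedin zariski Z \<and> Z \<subseteq> X"
  using closedin_closed_subtopology[OF closed] by blast

text \<open>Two disjoint nonempty open sets would have proper closed complements covering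
  \<open>X\<close>.\<close>

lemma open_dense:
  assumes "openin (zar X) U" "U \<noteq> {}" "openin (zar X) V" "V \<noteq> {}"
  shows "U \<inter> V \<noteq> {}"
proof
  assume "U \<inter> V = {}"
  then have "X = (X - U) \<union> (X - V)" by auto
  moreover have "closedin zariski (X - U)" "closedin zariski (X - V)"
    using assms(1,3) closedin_diff closedin_zar closedin_topspace topspace_X by metis+
  ultimately have "X = X - U \<or> X = X - V" using irreducible unfolding irreducible_closed_def by blast
  then show False using assms openin_X_subset by blast
qed

abbreviation near where "near \<equiv> nhdsin (zar X)"

text \<open>By \<open>open_dense\<close> the nonempty open sets are a filter base. As a filter,
  generic validity can be combined by \<open>eventually_elim\<close> in place of intersecting open
  sets by hand.\<close>

definition generic :: "('k, 'n) point filter" where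
  "generic = (INF U\<in>{U. openin (zar X) U \<and> U \<noteq> {}}. principal U)"

lemma eventually_generic:
  "eventually p generic \<longleftrightarrow> (\<exists>U. openin (zar X) U \<and> U \<noteq> {} \<and> (\<forall>Q\<in>U. p Q))"
  unfolding generic_def
proof (subst eventually_INF_base)
  show "{U. openin (zar X) U \<and> U \<noteq> {}} \<noteq> {}"
    using irreducible openin_X unfolding irreducible_closed_def by blast
next
  fix U V assume "U \<in> {U. openin (zar X) U \<and> U \<noteq> {}}" "V \<in> {U. openin (zar X) U \<and> U \<noteq> {}}"
  then show "\<exists>W\<in>{U. openin (zar X) U \<and> U \<noteq> {}}. principal W \<le> inf (principal U) (principal V)"
    using open_dense by (intro bexI[of _ "U \<inter> V"]) auto
qed (auto simp: eventually_principal)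

lemma generic_nontrivial: "generic \<noteq> bot"
  unfolding trivial_limit_def eventually_generic by blast

lemma eventually_genericI:
  assumes "openin (zar X) U" "U \<noteq> {}" "\<And>Q. Q \<in> U \<Longrightarrow> p Q"
  shows "eventually p generic"
  using assms unfolding eventually_generic by blast

lemma eq_generic_iff: "eq_generic X f g \<longleftrightarrow> (\<forall>\<^sub>F Q in generic. f Q = g Q)"
  unfolding eq_generic_def eventually_generic by simp

lemma eventually_near:
  "P \<in> X \<Longrightarrow> eventually p (near P) \<longleftrightarrow> (\<exists>U. openin (zar X) U \<and> P \<in> U \<and> (\<forall>Q\<in>U. p Q))"
  using eventually_nhdsin[of p "zar X" P] unfolding topspace_X by simp

lemma eq_near_iff: "P \<in> X \<Longrightarrow> eq_near X P f g \<longleftrightarrow> (\<forall>\<^sub>F Q in near P. f Q = g Q)"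
  unfolding eq_near_def eventually_near by simp

lemma near_open: "openin (zar X) U \<Longrightarrow> P \<in> U \<Longrightarrow> \<forall>\<^sub>F Q in near P. Q \<in> U"
  using openin_X_subset by (subst eventually_near) blast+

lemma near_imp_generic: "P \<in> X \<Longrightarrow> eventually p (near P) \<Longrightarrow> eventually p generic"
  unfolding eventually_near eventually_generic by blast

lemma near_imp_at: "P \<in> X \<Longrightarrow> eventually p (near P) \<Longrightarrow> p P"
  unfolding eventually_near by blast

definition quotient_at ::
  "('k ^ 'n \<Rightarrow> 'k) \<Rightarrow> ('k ^ 'n \<Rightarrow> 'k) \<Rightarrow> (('k, 'n) point \<Rightarrow> 'k) \<Rightarrow> ('k, 'n) point \<Rightarrow> bool" where
  "quotient_at G H f Q \<longleftrightarrow> (\<forall>v\<in>Q. v \<noteq> 0 \<longrightarrow> H v \<noteq> 0 \<and> f Q = G v / H v)"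

text \<open>The germ version of \<open>regular_on\<close>, in which neighbourhoods are hidden in the
  filter \<open>near P\<close>; \<open>regular_on_iff\<close> leads back to open sets.\<close>

definition regular_at :: "('k, 'n) point \<Rightarrow> (('k, 'n) point \<Rightarrow> 'k) \<Rightarrow> bool" where
  "regular_at P f \<longleftrightarrow>
     (\<exists>m G H. hom_poly m G \<and> hom_poly m H \<and> (\<forall>\<^sub>F Q in near P. quotient_at G H f Q))"

lemma regular_on_iff:
  assumes "openin (zar X) U"
  shows "regular_on X U f \<longleftrightarrow> (\<forall>P\<in>U. regular_at P f)"
proof -
  have "(\<exists>V. openin (zar X) V \<and> P \<in> V \<and> V \<subseteq> U \<and>
     (\<exists>m G H. hom_poly m G \<and> hom_poly m H \<and> (\<forall>Q\<in>V. quotient_at G H f Q))) \<longleftrightarrow> regular_at P f"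
    (is "?L \<longleftrightarrow> ?R") if P: "P \<in> U" for P
  proof
    have PX: "P \<in> X" using P assms openin_X_subset by blast
    show "?L \<Longrightarrow> ?R" unfolding regular_at_def eventually_near[OF PX] by blast
    assume ?R
    then obtain m G H V where "hom_poly m G" "hom_poly m H" "openin (zar X) V" "P \<in> V"
      "\<forall>Q\<in>V. quotient_at G H f Q"
      unfolding regular_at_def eventually_near[OF PX] by blast
    then show ?L using assms P by (intro exI[of _ "V \<inter> U"]) blast
  qed
  then show ?thesis unfolding regular_on_def quotient_at_def by simp
qed

lemma regular_at_open:
  assumes "regular_at P f" "P \<in> X"
  shows "\<forall>\<^sub>F Q in near P. regular_at Q f"
proof -
  obtain m G H U where U: "hom_poly m G" "hom_poly m H" "openin (zar X) U" "P \<in> U"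
    "\<forall>Q\<in>U. quotient_at G H f Q"
    using assms(1) unfolding regular_at_def eventually_near[OF assms(2)] by blast
  have "\<forall>\<^sub>F Q' in near Q. quotient_at G H f Q'" if "Q \<in> U" for Q
    using near_open[OF U(3) that] by eventually_elim (use U(5) in blast)
  then have "regular_at Q f" if "Q \<in> U" for Q
    unfolding regular_at_def using U(1,2) that by blast
  then show ?thesis unfolding eventually_near[OF assms(2)] using U by blast
qed

lemma local_ring_iff:
  assumes "P \<in> X"
  shows "f \<in> local_ring X P \<longleftrightarrow> regular_at P f"
proof
  assume "f \<in> local_ring X P"
  then show "regular_at P f" unfolding local_ring_def using regular_on_iff by blast
next
  assume "regular_at P f"
  from regular_at_open[OF this assms] show "f \<in> local_ring X P"
    unfolding eventually_near[OF assms] local_ring_def using regular_on_iff by blast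
qed

lemma struct_sheaf_iff:
  "openin (zar X) U \<Longrightarrow> f \<in> struct_sheaf X U \<longleftrightarrow> supported_on U f \<and> (\<forall>P\<in>U. regular_at P f)"
  unfolding struct_sheaf_def using regular_on_iff by blast

lemma regular_at_cong:
  assumes "\<forall>\<^sub>F Q in near P. f Q = g Q" "regular_at P f"
  shows "regular_at P g"
proof -
  obtain m G H where U: "hom_poly m G" "hom_poly m H"
    "\<forall>\<^sub>F Q in near P. quotient_at G H f Q"
    using assms(2) unfolding regular_at_def by blast
  have "\<forall>\<^sub>F Q in near P. quotient_at G H g Q"
    using U(3) assms(1) by eventually_elim (auto simp: quotient_at_def)
  then show ?thesis unfolding regular_at_def using U by blast
qed

lemma regular_at_cong_open:
  assumes "openin (zar X) U" "P \<in> U" "\<And>Q. Q \<in> U \<Longrightarrow> f Q = g Q" "regular_at P f"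
  shows "regular_at P g"
  using regular_at_cong[OF eventually_mono[OF near_open[OF assms(1,2)]] assms(4)] assms(3) by blast

lemma regular_at_const: "regular_at P (\<lambda>_. c)"
proof -
  have "\<forall>\<^sub>F Q in near P. quotient_at (\<lambda>_. c) (\<lambda>_. 1) (\<lambda>_. c) Q" by (simp add: quotient_at_def)
  then show ?thesis unfolding regular_at_def using hom_poly.const by blast
qed

lemma regular_at_add:
  assumes "regular_at P f" "regular_at P g"
  shows "regular_at P (\<lambda>Q. f Q + g Q)"
proof -
  obtain m G H where f: "hom_poly m G" "hom_poly m H"
    "\<forall>\<^sub>F Q in near P. quotient_at G H f Q"
    using assms(1) unfolding regular_at_def by blast
  obtain n K L where g: "hom_poly n K" "hom_poly n L"
    "\<forall>\<^sub>F Q in near P. quotient_at K L g Q"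
    using assms(2) unfolding regular_at_def by blast
  have "hom_poly (m + n) (\<lambda>v. G v * L v + H v * K v)" "hom_poly (m + n) (\<lambda>v. H v * L v)"
    using f g by (auto intro: hom_poly.intros)
  moreover have "\<forall>\<^sub>F Q in near P. quotient_at (\<lambda>v. G v * L v + H v * K v) (\<lambda>v. H v * L v) (\<lambda>Q. f Q + g Q) Q"
    using f(3) g(3) by eventually_elim (auto simp: quotient_at_def field_simps)
  ultimately show ?thesis unfolding regular_at_def by blast
qed

lemma regular_at_mult:
  assumes "regular_at P f" "regular_at P g"
  shows "regular_at P (\<lambda>Q. f Q * g Q)"
proof -
  obtain m G H where f: "hom_poly m G" "hom_poly m H"
    "\<forall>\<^sub>F Q in near P. quotient_at G H f Q"
    using assms(1) unfolding regular_at_def by blast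
  obtain n K L where g: "hom_poly n K" "hom_poly n L"
    "\<forall>\<^sub>F Q in near P. quotient_at K L g Q"
    using assms(2) unfolding regular_at_def by blast
  have "hom_poly (m + n) (\<lambda>v. G v * K v)" "hom_poly (m + n) (\<lambda>v. H v * L v)"
    using f g by (auto intro: hom_poly.intros)
  moreover have "\<forall>\<^sub>F Q in near P. quotient_at (\<lambda>v. G v * K v) (\<lambda>v. H v * L v) (\<lambda>Q. f Q * g Q) Q"
    using f(3) g(3) by eventually_elim (auto simp: quotient_at_def)
  ultimately show ?thesis unfolding regular_at_def by blast
qed

lemma regular_at_uminus: "regular_at P f \<Longrightarrow> regular_at P (\<lambda>Q. - f Q)"
  using regular_at_mult[OF regular_at_const[of P "-1"], of f] by simp

lemma regular_at_diff: "regular_at P f \<Longrightarrow> regular_at P g \<Longrightarrow> regular_at P (\<lambda>Q. f Q - g Q)"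
  using regular_at_add[of P f, OF _ regular_at_uminus] by simp

lemma regular_at_power: "regular_at P f \<Longrightarrow> regular_at P (\<lambda>Q. f Q ^ m)"
  by (induction m) (auto intro: regular_at_const regular_at_mult)

lemma regular_at_sum: "(\<And>i. i \<in> A \<Longrightarrow> regular_at P (f i)) \<Longrightarrow> regular_at P (\<lambda>Q. \<Sum>i\<in>A. f i Q)"
  by (induction A rule: infinite_finite_induct) (auto intro: regular_at_const regular_at_add)

text \<open>The fraction has to represent \<open>f\<close> only off the zeros of \<open>H\<close>,
  which is how the normalised coordinates \<open>v $ j / v $ i\<close> arise.\<close>

lemma regular_at_quotient:
  assumes "hom_poly m G" "hom_poly m H" "P \<in> X" "v \<in> P" "H v \<noteq> 0"
    "\<And>Q v. Q \<in> X \<Longrightarrow> v \<in> Q \<Longrightarrow> v \<noteq> 0 \<Longrightarrow> H v \<noteq> 0 \<Longrightarrow> f Q = G v / H v"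
  shows "regular_at P f"
proof -
  have "P \<in> {Q \<in> X. \<forall>v\<in>Q. v \<noteq> 0 \<longrightarrow> H v \<noteq> 0}"
    using assms(3-5) vanish_line[OF assms(3,2)] by auto
  from near_open[OF openin_nonvanishing[OF assms(2) subset_proj_space] this]
  have "\<forall>\<^sub>F Q in near P. quotient_at G H f Q"
    by eventually_elim (use assms(6) in \<open>auto simp: quotient_at_def\<close>)
  then show ?thesis unfolding regular_at_def using assms by blast
qed

text \<open>If \<open>f = G / H\<close> near \<open>P\<close> and \<open>f P \<noteq> 0\<close>,
  then \<open>G\<close> has no zero at \<open>P\<close>, and \<open>H / G\<close> represents the
  inverse.\<close>

lemma regular_at_nonzero:
  assumes "regular_at P f" "P \<in> X" "f P \<noteq> 0"
  shows "\<forall>\<^sub>F Q in near P. f Q \<noteq> 0" "regular_at P (\<lambda>Q. inverse (f Q))"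
proof -
  obtain m G H where f: "hom_poly m G" "hom_poly m H"
    "\<forall>\<^sub>F Q in near P. quotient_at G H f Q"
    using assms(1) unfolding regular_at_def by blast
  have "P \<in> {Q \<in> X. \<forall>v\<in>Q. v \<noteq> 0 \<longrightarrow> G v \<noteq> 0}"
    using near_imp_at[OF assms(2) f(3)] assms(2,3) by (auto simp: quotient_at_def)
  from near_open[OF openin_nonvanishing[OF f(1) subset_proj_space] this]
  have G: "\<forall>\<^sub>F Q in near P. Q \<in> X \<and> (\<forall>v\<in>Q. v \<noteq> 0 \<longrightarrow> G v \<noteq> 0)" by simp
  then show "\<forall>\<^sub>F Q in near P. f Q \<noteq> 0"
    using f(3)
  proof eventually_elim
    case (elim Q)
    then obtain v where "v \<in> Q" "v \<noteq> 0" using point_nonzero[of Q] by auto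
    then show ?case using elim by (auto simp: quotient_at_def)
  qed
  have "\<forall>\<^sub>F Q in near P. quotient_at H G (\<lambda>Q. inverse (f Q)) Q"
    using G f(3) by eventually_elim (auto simp: quotient_at_def)
  then show "regular_at P (\<lambda>Q. inverse (f Q))" unfolding regular_at_def using f by blast
qed

lemma openin_regular_nonzero:
  assumes "openin (zar X) U" "\<And>P. P \<in> U \<Longrightarrow> regular_at P f"
  shows "openin (zar X) {Q \<in> U. f Q \<noteq> 0}"
proof (subst openin_subopen, intro ballI)
  fix P assume P: "P \<in> {Q \<in> U. f Q \<noteq> 0}"
  then have PX: "P \<in> X" using assms(1) openin_X_subset by blast
  then have "\<forall>\<^sub>F Q in near P. Q \<in> U \<and> f Q \<noteq> 0"
    using P assms regular_at_nonzero(1) near_open by (intro eventually_conj) auto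
  then show "\<exists>T. openin (zar X) T \<and> P \<in> T \<and> T \<subseteq> {Q \<in> U. f Q \<noteq> 0}"
    unfolding eventually_near[OF PX] by blast
qed

text \<open>The identity principle. A numerator \<open>G\<close> of \<open>f\<close> vanishes on a
  nonempty open set, so by density its basic open set in \<open>X\<close> is empty. Thus
  \<open>G\<close> vanishes on all of \<open>X\<close>, and \<open>f\<close> does so wherever the
  fraction represents it.\<close>

lemma regular_generic_zero:
  assumes "regular_at P f" "P \<in> X" "\<forall>\<^sub>F Q in generic. f Q = 0"
  shows "\<forall>\<^sub>F Q in near P. f Q = 0"
proof -
  obtain m G H where f: "hom_poly m G" "hom_poly m H"
    "\<forall>\<^sub>F Q in near P. quotient_at G H f Q"
    using assms(1) unfolding regular_at_def by blast
  have "\<forall>\<^sub>F Q in generic. \<forall>v\<in>Q. v \<noteq> 0 \<longrightarrow> G v = 0"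
    using near_imp_generic[OF assms(2) f(3)] assms(3) by eventually_elim (auto simp: quotient_at_def)
  then obtain U where U: "openin (zar X) U" "U \<noteq> {}" "\<forall>Q\<in>U. \<forall>v\<in>Q. v \<noteq> 0 \<longrightarrow> G v = 0"
    unfolding eventually_generic by (elim exE conjE)
  have "{Q \<in> X. \<forall>v\<in>Q. v \<noteq> 0 \<longrightarrow> G v \<noteq> 0} = {}"
  proof (rule ccontr)
    assume "{Q \<in> X. \<forall>v\<in>Q. v \<noteq> 0 \<longrightarrow> G v \<noteq> 0} \<noteq> {}"
    then have "U \<inter> {Q \<in> X. \<forall>v\<in>Q. v \<noteq> 0 \<longrightarrow> G v \<noteq> 0} \<noteq> {}"
      by (rule open_dense[OF U(1,2) openin_nonvanishing[OF f(1) subset_proj_space]])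
    then obtain Q where "Q \<in> U" "Q \<in> X" "\<forall>v\<in>Q. v \<noteq> 0 \<longrightarrow> G v \<noteq> 0" by auto
    then show False using point_nonzero[of Q] U(3) by auto
  qed
  then have G: "G v = 0" if "Q \<in> X" "v \<in> Q" for Q v
  proof -
    obtain w where w: "w \<in> Q" "w \<noteq> 0" "G w = 0"
      using \<open>{Q \<in> X. \<forall>v\<in>Q. v \<noteq> 0 \<longrightarrow> G v \<noteq> 0} = {}\<close> \<open>Q \<in> X\<close> by auto
    show ?thesis by (rule vanish_line[OF that(1) f(1) w that(2)])
  qed
  have "\<forall>\<^sub>F Q in near P. Q \<in> X" using near_open[OF openin_X assms(2)] .
  then show ?thesis using f(3)
  proof eventually_elim
    case (elim Q)
    then obtain v where "v \<in> Q" "v \<noteq> 0" using point_nonzero[of Q] by auto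
    then show ?case using elim G by (auto simp: quotient_at_def)
  qed
qed

lemma regular_generic_eq:
  assumes "regular_at P f" "regular_at P g" "P \<in> X" "\<forall>\<^sub>F Q in generic. f Q = g Q"
  shows "\<forall>\<^sub>F Q in near P. f Q = g Q"
  using regular_generic_zero[OF regular_at_diff[OF assms(1,2)] assms(3)] assms(4) by simp

lemma regular_not_generic_zero:
  assumes "regular_at P f" "P \<in> X" "\<not> (\<forall>\<^sub>F Q in generic. f Q = 0)"
  shows "\<forall>\<^sub>F Q in generic. f Q \<noteq> 0"
proof -
  obtain U where U: "openin (zar X) U" "P \<in> U" "\<And>Q. Q \<in> U \<Longrightarrow> regular_at Q f"
    using regular_at_open[OF assms(1,2)] unfolding eventually_near[OF assms(2)] by blast
  have "{Q \<in> U. f Q \<noteq> 0} \<noteq> {}" using assms(3) U(1,2) unfolding eventually_generic by blast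
  then show ?thesis using openin_regular_nonzero[OF U(1,3)] unfolding eventually_generic by blast
qed

end

section \<open>Curves and orders of vanishing\<close>

lemma (in irreducible_variety) irreducible_closed_zar:
  assumes "irreducible_closed zariski Z" "Z \<subseteq> X"
  shows "irreducible_closed (zar X) Z"
  unfolding irreducible_closed_def
proof (intro conjI allI impI)
  show "closedin (zar X) Z" "Z \<noteq> {}"
    using assms closedin_zar[of Z] unfolding irreducible_closed_def by simp_all
  fix Y Y' assume "closedin (zar X) Y \<and> closedin (zar X) Y' \<and> Z = Y \<union> Y'"
  then have "closedin zariski Y \<and> closedin zariski Y' \<and> Z = Y \<union> Y'" by (simp add: closedin_zar)
  then show "Z = Y \<or> Z = Y'" using assms(1) unfolding irreducible_closed_def by simp
qed

locale smooth_curve = irreducible_variety C for C :: "('k::field, 'n::finite) point set" +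
  assumes krull_dim: "has_krull_dim (zar C) 1"
    and smooth: "P \<in> C \<Longrightarrow> smooth_curve_point C P"
begin

text \<open>Otherwise a point of \<open>Z\<close>, the set \<open>Z\<close> and \<open>C\<close>
  would be a chain of three irreducible closed sets, against Krull dimension 1.\<close>

lemma irreducible_proper_point:
  assumes "irreducible_closed zariski Z" "Z \<subset> C"
  shows "\<exists>P. Z = {P}"
proof (rule ccontr)
  assume no: "\<nexists>P. Z = {P}"
  have irrZ: "irreducible_closed (zar C) Z" and irrC: "irreducible_closed (zar C) C"
    using assms irreducible by (auto intro!: irreducible_closed_zar)
  obtain P where P: "P \<in> Z" using assms(1) unfolding irreducible_closed_def by blast
  have "closedin (zar C) {P}"
    using closedin_zariski_point[of P] P assms(2) subset_proj_space by (auto simp: closedin_zar)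
  then have irrP: "irreducible_closed (zar C) {P}"
    unfolding irreducible_closed_def by (metis Un_empty_left insert_not_empty subset_singletonD sup_ge1)
  define c where "c i = (if i = 0 then {P} else if i = 1 then Z else C)" for i :: nat
  have "{P} \<subset> Z" using P no by blast
  then have "irreducible_chain (zar C) (Suc 1) c"
    unfolding irreducible_chain_def c_def using irrP irrZ irrC assms(2) by (auto simp: less_Suc_eq)
  then show False using krull_dim unfolding has_krull_dim_def by blast
qed

text \<open>Noetherian induction: a reducible closed set is a union of two smaller closed sets, and
  an irreducible one properly inside \<open>C\<close> is a point.\<close>

lemma finite_proper_closed:
  assumes "closedin zariski Z" "Z \<subset> C"
  shows "finite Z"
  using assms
proof (induction Z rule: wf_induct_rule[OF closedin_zariski_wf])
  case (1 Z)
  show ?case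
  proof (cases "irreducible_closed zariski Z \<or> Z = {}")
    case True
    then show ?thesis using irreducible_proper_point 1 by force
  next
    case False
    then obtain Y Y' where Y: "closedin zariski Y" "closedin zariski Y'" "Z = Y \<union> Y'" "Z \<noteq> Y" "Z \<noteq> Y'"
      using 1(2) unfolding irreducible_closed_def by blast
    have "finite Y" "finite Y'"
      using 1(1)[of Y] 1(1)[of Y'] Y 1(2,3) by auto
    then show ?thesis unfolding Y(3) by simp
  qed
qed

lemma finite_compl_open:
  assumes "openin (zar C) U" "U \<noteq> {}"
  shows "finite (C - U)"
proof (rule finite_proper_closed)
  show "closedin zariski (C - U)" using openin_closedin_eq[of "zar C"] assms(1) closedin_zar topspace_X by metis
  show "C - U \<subset> C" using openin_X_subset[OF assms(1)] assms(2) by blast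
qed

lemma generic_finite: "eventually p generic \<Longrightarrow> finite {Q \<in> C. \<not> p Q}"
  unfolding eventually_generic
  by (elim exE conjE) (rule finite_subset[OF _ finite_compl_open], auto)

section \<open>Uniformizers\<close>

lemma uniformizer_iff:
  assumes "P \<in> C"
  shows "uniformizer C P t \<longleftrightarrow> regular_at P t \<and> t P = 0 \<and>
    (\<forall>f. regular_at P f \<and> f P = 0 \<longrightarrow> (\<exists>g. regular_at P g \<and> (\<forall>\<^sub>F Q in near P. f Q = g Q * t Q)))"
  unfolding uniformizer_def max_ideal_def using assms
  by (simp add: local_ring_iff eq_near_iff times_fun_def Bex_def)

text \<open>If \<open>t\<close> were generically zero, it would be zero near \<open>P\<close>, and
  with it every germ of the maximal ideal, all of them being multiples of \<open>t\<close>. But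
  smoothness provides a germ outside the square of that ideal.\<close>

lemma uniformizer_generic_nonzero:
  assumes P: "P \<in> C" and t: "uniformizer C P t"
  shows "\<forall>\<^sub>F Q in generic. t Q \<noteq> 0"
proof (rule ccontr)
  note tt = t[unfolded uniformizer_iff[OF P]]
  assume "\<not> ?thesis"
  then have "\<forall>\<^sub>F Q in generic. t Q = 0" using regular_not_generic_zero[of P t] P tt by blast
  then have t0: "\<forall>\<^sub>F Q in near P. t Q = 0" using regular_generic_zero P tt by blast
  obtain f where f: "f \<in> max_ideal C P" "f \<notin> max_ideal_sq C P"
    using smooth[OF P] unfolding smooth_curve_point_def by blast
  then have fr: "regular_at P f" "f P = 0" using P by (auto simp: max_ideal_def local_ring_iff)
  then obtain g where "\<forall>\<^sub>F Q in near P. f Q = g Q * t Q" using tt by blast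
  then have "\<forall>\<^sub>F Q in near P. f Q = 0" using t0 by eventually_elim simp
  \<comment> \<open>The zero germ is an empty sum of products, so \<open>n = 0\<close> puts
    \<open>f\<close> into \<open>max_ideal_sq\<close>.\<close>
  then have "eq_near C P f (\<lambda>Q. \<Sum>i<(0::nat). undefined i * undefined i)"
    by (simp add: eq_near_iff[OF P])
  then have "f \<in> max_ideal_sq C P" using f(1) unfolding max_ideal_sq_def max_ideal_def
    by (auto intro!: exI[of _ "0::nat"])
  then show False using f(2) by blast
qed

end

context irreducible_variety
begin

text \<open>
  Krull's intersection theorem for the principal ideal of \<open>t\<close>: from \<open>f = g\<^sub>n t\<^sup>n\<close> for all \<open>n\<close>, the
  chain condition puts some \<open>g\<^sub>N\<close> in the ideal of the \<open>g\<^sub>i\<close> with \<open>i < N\<close>, that is \<open>g\<^sub>N (1 - h t) = 0\<close>. The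
  regular functions near \<open>P\<close> are fractions of polynomial functions evaluated at the representatives
  normalised by \<open>v $ i = 1\<close>.
\<close>

lemma infinitely_divisible_zero:
  assumes P: "P \<in> X" and t: "regular_at P t" "t P = 0"
    and g: "\<And>n. regular_at P (g n)" "\<And>n. \<forall>\<^sub>F Q in near P. g n Q = g (Suc n) Q * t Q"
  shows "\<forall>\<^sub>F Q in near P. g 0 Q = 0"
proof -
  have "\<forall>n. \<exists>m G H. hom_poly m G \<and> hom_poly m H \<and> (\<forall>\<^sub>F Q in near P. quotient_at G H (g n) Q)"
    using g(1) unfolding regular_at_def by blast
  then obtain m G H where GH: "\<And>n. hom_poly (m n) (G n)" "\<And>n. hom_poly (m n) (H n)"
    "\<And>n. \<forall>\<^sub>F Q in near P. quotient_at (G n) (H n) (g n) Q" by metis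
  have "\<forall>n. G n \<in> poly_funs" using GH(1) hom_poly_in_poly_funs by blast
  then obtain N where "G N \<in> combinations poly_funs N G"
    using noetherian_poly_funs unfolding noetherian_def by blast
  then obtain c where c: "\<forall>i<N. c i \<in> poly_funs" "G N = (\<Sum>i<N. c i * G i)"
    unfolding combinations_def by blast
  obtain u where u: "u \<in> P" "u \<noteq> 0" using point_nonzero[OF P] by blast
  then obtain i where i: "u $ i \<noteq> 0" by (metis vec_eq_iff zero_index)
  define U where "U = {Q \<in> X. \<forall>v\<in>Q. v \<noteq> 0 \<longrightarrow> v $ i \<noteq> 0}"
  have U: "openin (zar X) U" unfolding U_def
    by (rule openin_nonvanishing[OF hom_poly.coord subset_proj_space])
  have PU: "P \<in> U" unfolding U_def using vanish_line[OF P hom_poly.coord[of i] _ _ _ u(1)] i P by auto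
  \<comment> \<open>The numerators \<open>G j\<close> differ in degree and the cofactors
    \<open>c j\<close> need not be homogeneous, so the relation between them makes sense at a point
    only after a representative is fixed. Normalising one coordinate to 1 turns polynomial functions
    into regular functions.\<close>
  define nv where "nv Q = (SOME v. v \<in> Q \<and> v $ i = 1)" for Q :: "('k, 'n) point"
  have nv: "nv Q \<in> Q \<and> nv Q $ i = 1" if "Q \<in> U" for Q
  proof -
    have QX: "Q \<in> X" using that unfolding U_def by simp
    then obtain v where v: "v \<in> Q" "v \<noteq> 0" using point_nonzero by blast
    then have "v $ i \<noteq> 0" using that unfolding U_def by simp
    moreover have "(1 / v $ i) *s v \<in> Q"
    proof -
      obtain w where "Q = vec.span {w}"
        using subsetD[OF subset_proj_space QX] unfolding proj_space_def by auto
      then show ?thesis using v(1) by (simp add: vec.span_scale)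
    qed
    ultimately have "\<exists>w. w \<in> Q \<and> w $ i = 1" by (intro exI[of _ "(1 / v $ i) *s v"]) simp
    then show ?thesis unfolding nv_def by (rule someI_ex)
  qed
  have nv0: "nv Q \<noteq> 0" if "Q \<in> U" for Q using nv[OF that] by (metis zero_index zero_neq_one)
  have reg: "regular_at P (\<lambda>Q. F (nv Q))" if "F \<in> poly_funs" for F
    using that
  proof induction
    case (coord j)
    have "nv Q $ j = v $ j / v $ i" if Q: "Q \<in> X" "v \<in> Q" "v \<noteq> 0" "v $ i \<noteq> 0" for Q v
    proof -
      have "Q \<in> U" unfolding U_def using vanish_line[OF Q(1) hom_poly.coord[of i] _ _ _ Q(2)] Q by auto
      note n = nv[OF this] nv0[OF this]
      obtain k where k: "v = k *s nv Q"
        using proj_space_line[of Q "nv Q" v] n Q(1,2) subset_proj_space by auto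
      then have "v $ j = k * nv Q $ j" "v $ i = k" using n by auto
      then show ?thesis using Q(4) by simp
    qed
    then have "regular_at P (\<lambda>Q. nv Q $ j)"
      by (rule regular_at_quotient[OF hom_poly.coord[of j] hom_poly.coord[of i] P u(1) i])
    then show ?case .
  next
    case (diff F G)
    then show ?case using regular_at_diff[OF diff.IH] by simp
  next
    case (mult F G)
    then show ?case using regular_at_mult[OF mult.IH] by simp
  qed (simp add: regular_at_const)
  \<comment> \<open>Inserting \<open>G j = H j g j\<close> and \<open>g j = g N t^(N - j)\<close>
    into the relation for \<open>G N\<close> gives \<open>g N b = 0\<close>. All exponents
    \<open>N - j\<close> are positive and \<open>t P = 0\<close>, so \<open>b P\<close> is the
    denominator \<open>H N (nv P)\<close>, which is nonzero.\<close>
  define b where "b Q = H N (nv Q) - (\<Sum>j<N. c j (nv Q) * H j (nv Q) * t Q ^ (N - j))" for Q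
  have Hr: "regular_at P (\<lambda>Q. H j (nv Q))" for j
    using reg[of "H j"] hom_poly_in_poly_funs[OF GH(2)] by simp
  have cr: "regular_at P (\<lambda>Q. c j (nv Q))" if "j < N" for j
    using reg[of "c j"] c(1) that by simp
  have "regular_at P (\<lambda>Q. c j (nv Q) * H j (nv Q) * t Q ^ (N - j))" if "j < N" for j
    using regular_at_mult[OF regular_at_mult[OF cr[OF that] Hr] regular_at_power[OF t(1)]] .
  then have "regular_at P (\<lambda>Q. \<Sum>j<N. c j (nv Q) * H j (nv Q) * t Q ^ (N - j))"
    by (intro regular_at_sum) simp
  from regular_at_diff[OF Hr this] have b: "regular_at P b" unfolding b_def .
  have pow: "\<forall>\<^sub>F Q in near P. g (N - k) Q = g N Q * t Q ^ k" if "k \<le> N" for k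
    using that
  proof (induction k)
    case (Suc k)
    then have "\<forall>\<^sub>F Q in near P. g (N - k) Q = g N Q * t Q ^ k" by simp
    moreover have "\<forall>\<^sub>F Q in near P. g (N - Suc k) Q = g (N - k) Q * t Q"
      using g(2)[of "N - Suc k"] Suc.prems by (simp add: Suc_diff_Suc)
    ultimately show ?case by eventually_elim (simp add: mult.assoc mult.commute[of "t _"])
  qed simp
  have all: "\<forall>\<^sub>F Q in near P. \<forall>j\<in>{..N}. quotient_at (G j) (H j) (g j) Q \<and> g j Q = g N Q * t Q ^ (N - j)"
  proof (rule eventually_ball_finite, simp, intro ballI)
    fix j assume "j \<in> {..N}"
    then show "\<forall>\<^sub>F Q in near P. quotient_at (G j) (H j) (g j) Q \<and> g j Q = g N Q * t Q ^ (N - j)"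
      using GH(3)[of j] pow[of "N - j"] by (simp add: eventually_conj)
  qed
  have fr: "G j (nv Q) = H j (nv Q) * g j Q \<and> H j (nv Q) \<noteq> 0" if "Q \<in> U" "quotient_at (G j) (H j) (g j) Q" for j Q
  proof -
    have "H j (nv Q) \<noteq> 0" "g j Q = G j (nv Q) / H j (nv Q)"
      using that(2) nv[OF that(1)] nv0[OF that(1)] unfolding quotient_at_def by blast+
    then show ?thesis by simp
  qed
  have "H N (nv P) \<noteq> 0" using fr[OF PU] near_imp_at[OF P all] by blast
  moreover have "(\<Sum>j<N. c j (nv P) * H j (nv P) * t P ^ (N - j)) = 0"
    by (rule sum.neutral) (simp add: t(2))
  ultimately have "b P \<noteq> 0" unfolding b_def by simp
  from regular_at_nonzero(1)[OF b P this] near_open[OF U PU] all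
  have "\<forall>\<^sub>F Q in near P. g N Q = 0"
  proof eventually_elim
    case (elim Q)
    have q: "G j (nv Q) = H j (nv Q) * (g N Q * t Q ^ (N - j))" if "j \<le> N" for j
    proof -
      have "g j Q = g N Q * t Q ^ (N - j)" "quotient_at (G j) (H j) (g j) Q"
        using elim(3) that by (blast intro: atMost_iff[THEN iffD2])+
      then show ?thesis using fr[OF elim(2)] by metis
    qed
    have "H N (nv Q) * g N Q = (\<Sum>j<N. c j (nv Q) * G j (nv Q))"
      using q[of N] by (simp add: c(2) sum_apply)
    also have "\<dots> = g N Q * (\<Sum>j<N. c j (nv Q) * H j (nv Q) * t Q ^ (N - j))"
      unfolding sum_distrib_left by (rule sum.cong) (auto simp: q)
    finally have "g N Q * b Q = 0" unfolding b_def by (simp add: algebra_simps)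
    then show ?case using elim(1) by simp
  qed
  with pow[of N] show ?thesis by simp (elim eventually_rev_mp, simp)
qed

end

context smooth_curve
begin

text \<open>Divide by \<open>t\<close> as long as the quotient vanishes at \<open>P\<close>. If this
  never stopped, \<open>f\<close> would be zero near \<open>P\<close> by
  \<open>infinitely_divisible_zero\<close>, hence generically zero.\<close>

lemma regular_order:
  assumes P: "P \<in> C" and t: "uniformizer C P t" and f: "regular_at P f"
    and nz: "\<forall>\<^sub>F Q in generic. f Q \<noteq> 0"
  shows "\<exists>m w. regular_at P w \<and> w P \<noteq> 0 \<and> (\<forall>\<^sub>F Q in near P. f Q = w Q * t Q ^ m)"
proof (rule ccontr)
  assume no: "\<not> ?thesis"
  note tt = t[unfolded uniformizer_iff[OF P]]
  define D where "D n g \<longleftrightarrow> regular_at P g \<and> (\<forall>\<^sub>F Q in near P. f Q = g Q * t Q ^ n)" for n g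
  have "\<exists>g. \<forall>n. D n (g n) \<and> (\<forall>\<^sub>F Q in near P. g n Q = g (Suc n) Q * t Q)"
  proof (rule dependent_nat_choice)
    show "\<exists>g. D 0 g" unfolding D_def using f by (intro exI[of _ f]) simp
  next
    fix g n assume g: "D n g"
    then have "g P = 0" using no unfolding D_def by blast
    then obtain h where h: "regular_at P h" "\<forall>\<^sub>F Q in near P. g Q = h Q * t Q"
      using tt g unfolding D_def by blast
    have "\<forall>\<^sub>F Q in near P. f Q = g Q * t Q ^ n" using g unfolding D_def by blast
    then have "\<forall>\<^sub>F Q in near P. f Q = h Q * t Q ^ Suc n" using h(2) by eventually_elim simp
    then show "\<exists>h. D (Suc n) h \<and> (\<forall>\<^sub>F Q in near P. g Q = h Q * t Q)" unfolding D_def using h by blast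
  qed
  then obtain g where g: "\<And>n. D n (g n)" "\<And>n. \<forall>\<^sub>F Q in near P. g n Q = g (Suc n) Q * t Q" by blast
  have "\<forall>\<^sub>F Q in near P. g 0 Q = 0"
    by (rule infinitely_divisible_zero[where g = g, OF P _ _ _ g(2)]) (use tt g(1) in \<open>auto simp: D_def\<close>)
  moreover have "\<forall>\<^sub>F Q in near P. f Q = g 0 Q" using g(1)[of 0] unfolding D_def by simp
  ultimately have "\<forall>\<^sub>F Q in near P. f Q = 0" by eventually_elim simp
  from near_imp_generic[OF P this] nz have "\<forall>\<^sub>F Q in generic. False" by eventually_elim simp
  then show False using generic_nontrivial by (simp add: trivial_limit_def)
qed

end

section \<open>Frames and generated subsheaves\<close>

context irreducible_variety
begin

section \<open>Line bundles through their local frames\<close>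

lemma near_near: "P \<in> X \<Longrightarrow> \<forall>\<^sub>F Q in near P. p Q \<Longrightarrow> \<forall>\<^sub>F Q in near P. \<forall>\<^sub>F Q' in near Q. p Q'"
  by (subst eventually_near, assumption, subst (asm) eventually_near, assumption)
    (metis (mono_tags, lifting) near_open eventually_mono)

lemma frame_open: "frame X F U e \<Longrightarrow> openin (zar X) U"
  unfolding frame_def by blast

lemma frame_nonzero: "frame X F U e \<Longrightarrow> \<forall>\<^sub>F Q in generic. e Q \<noteq> 0"
  unfolding frame_def eventually_generic by blast

lemma frame_sections:
  "frame X F U e \<Longrightarrow> openin (zar X) V \<Longrightarrow> V \<subseteq> U \<Longrightarrow> F V = (\<lambda>f. f * e) ` struct_sheaf X V"
  unfolding frame_def by blast

lemma module_sheaf_supported: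
  "module_sheaf X F \<Longrightarrow> openin (zar X) U \<Longrightarrow> s \<in> F U \<Longrightarrow> supported_on U s"
  unfolding module_sheaf_def by simp

lemma section_in_frame:
  assumes "module_sheaf X F" "frame X F U e" "openin (zar X) V" "s \<in> F V"
  shows "\<exists>f. (\<forall>P\<in>U \<inter> V. regular_at P f) \<and> (\<forall>P\<in>U \<inter> V. s P = f P * e P)"
proof -
  have V: "openin (zar X) (U \<inter> V)" using assms(3) frame_open[OF assms(2)] by (rule openin_Int[rotated])
  then have "restr (U \<inter> V) s \<in> F (U \<inter> V)"
    using assms(1,3,4) unfolding module_sheaf_def by (meson Int_lower2)
  then obtain f where f: "f \<in> struct_sheaf X (U \<inter> V)" "restr (U \<inter> V) s = f * e"
    using frame_sections[OF assms(2) V] by auto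
  have "s P = f P * e P" if "P \<in> U \<inter> V" for P
    using fun_cong[OF f(2), of P] that by (simp add: restr_def)
  then show ?thesis using f(1) struct_sheaf_iff[OF V] by blast
qed

text \<open>At a point where \<open>s\<close> is nonzero its coefficient in a frame is nonzero as
  well and stays so nearby, while the frame is nonzero generically.\<close>

lemma nonzero_section_generic:
  assumes "line_bundle X F" "s \<in> H0 X F" "s \<noteq> 0"
  shows "\<forall>\<^sub>F Q in generic. s Q \<noteq> 0"
proof -
  have M: "module_sheaf X F" using assms(1) unfolding line_bundle_def by blast
  obtain P where P: "s P \<noteq> 0" using assms(3) by (auto simp: fun_eq_iff)
  have "supported_on X s" by (rule module_sheaf_supported[OF M openin_X assms(2)[unfolded H0_def]])
  then have PX: "P \<in> X" using P unfolding supported_on_def by auto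
  then obtain U e where U: "P \<in> U" "frame X F U e"
    using bspec[OF conjunct2[OF assms(1)[unfolded line_bundle_def]] PX] by (elim exE conjE)
  obtain f where f: "\<forall>P\<in>U \<inter> X. regular_at P f" "\<forall>P\<in>U \<inter> X. s P = f P * e P"
    using section_in_frame[OF M U(2) openin_X assms(2)[unfolded H0_def]] by (elim exE conjE)
  have "\<forall>\<^sub>F Q in near P. f Q \<noteq> 0" by (rule regular_at_nonzero(1)[OF _ PX]) (use f P PX U(1) in auto)
  then have "\<forall>\<^sub>F Q in generic. f Q \<noteq> 0" by (rule near_imp_generic[OF PX])
  moreover have "\<forall>\<^sub>F Q in generic. Q \<in> U" by (rule near_imp_generic[OF PX near_open[OF frame_open[OF U(2)] U(1)]])
  ultimately show ?thesis using frame_nonzero[OF U(2)]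
    by eventually_elim (use f(2) openin_X_subset[OF frame_open[OF U(2)]] in auto)
qed

text \<open>Each frame is a regular multiple of the other. The product of the two factors is 1 where
  the frames do not vanish, hence near \<open>P\<close> by the identity principle; so the factor is
  a unit even if both frames vanish at \<open>P\<close>.\<close>

lemma frame_ratio:
  assumes "module_sheaf X F" "frame X F U e" "frame X F U' e'" "P \<in> U" "P \<in> U'"
  shows "\<exists>x. regular_at P x \<and> x P \<noteq> 0 \<and> (\<forall>\<^sub>F Q in near P. e' Q = x Q * e Q)"
proof -
  note o = frame_open[OF assms(2)] frame_open[OF assms(3)]
  have PX: "P \<in> X" using assms(4) openin_X_subset[OF o(1)] by blast
  have ee: "e \<in> F U" "e' \<in> F U'" using assms(2,3) unfolding frame_def by auto
  obtain x where x: "\<forall>P\<in>U \<inter> U'. regular_at P x" "\<forall>P\<in>U \<inter> U'. e' P = x P * e P"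
    using section_in_frame[OF assms(1,2) o(2) ee(2)] by (elim exE conjE)
  obtain y where y: "\<forall>P\<in>U' \<inter> U. regular_at P y" "\<forall>P\<in>U' \<inter> U. e P = y P * e' P"
    using section_in_frame[OF assms(1,3) o(1) ee(1)] by (elim exE conjE)
  have n: "\<forall>\<^sub>F Q in near P. Q \<in> U \<inter> U'" using near_open[OF openin_Int[OF o] IntI[OF assms(4,5)]] .
  from near_imp_generic[OF PX this] frame_nonzero[OF assms(2)]
  have "\<forall>\<^sub>F Q in generic. x Q * y Q = 1"
  proof eventually_elim
    case (elim Q)
    then have "e' Q = x Q * e Q" "e Q = y Q * e' Q" using x(2) y(2) by blast+
    then have "1 * e Q = (x Q * y Q) * e Q" by (metis mult.assoc mult.commute mult_1)
    then show ?case using elim(2) by (metis mult_right_cancel)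
  qed
  then have "\<forall>\<^sub>F Q in near P. x Q * y Q = 1"
    using regular_generic_eq[where f = "\<lambda>Q. x Q * y Q" and g = "\<lambda>_. 1", OF regular_at_mult regular_at_const PX]
      x(1) y(1) assms(4,5) by simp
  from near_imp_at[OF PX this] have "x P \<noteq> 0" by auto
  moreover have "\<forall>\<^sub>F Q in near P. e' Q = x Q * e Q" using n by eventually_elim (use x(2) in auto)
  moreover have "regular_at P x" using x(1) assms(4,5) by simp
  ultimately show ?thesis by (intro exI[of _ x] conjI)
qed

section \<open>The sheaf generated by a pencil with a local generator\<close>

lemma subspace_multiples:
  "fun_vs.subspace {w. \<exists>k. (\<forall>Q\<in>V. regular_at Q k) \<and> (\<forall>Q\<in>V. w Q = k Q * a Q)}"
  unfolding fun_vs.subspace_def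
proof (intro conjI ballI allI)
  show "0 \<in> {w. \<exists>k. (\<forall>Q\<in>V. regular_at Q k) \<and> (\<forall>Q\<in>V. w Q = k Q * a Q)}"
    using regular_at_const[of _ 0] by (auto intro!: exI[of _ "\<lambda>_. 0"])
next
  fix w w' assume "w \<in> {w. \<exists>k. (\<forall>Q\<in>V. regular_at Q k) \<and> (\<forall>Q\<in>V. w Q = k Q * a Q)}"
    "w' \<in> {w. \<exists>k. (\<forall>Q\<in>V. regular_at Q k) \<and> (\<forall>Q\<in>V. w Q = k Q * a Q)}"
  then obtain k k' where "\<forall>Q\<in>V. regular_at Q k" "\<forall>Q\<in>V. w Q = k Q * a Q"
    "\<forall>Q\<in>V. regular_at Q k'" "\<forall>Q\<in>V. w' Q = k' Q * a Q" by auto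
  then show "w + w' \<in> {w. \<exists>k. (\<forall>Q\<in>V. regular_at Q k) \<and> (\<forall>Q\<in>V. w Q = k Q * a Q)}"
    using regular_at_add[of _ k k'] by (auto intro!: exI[of _ "\<lambda>Q. k Q + k' Q"] simp: algebra_simps)
next
  fix c w assume "w \<in> {w. \<exists>k. (\<forall>Q\<in>V. regular_at Q k) \<and> (\<forall>Q\<in>V. w Q = k Q * a Q)}"
  then obtain k where "\<forall>Q\<in>V. regular_at Q k" "\<forall>Q\<in>V. w Q = k Q * a Q" by auto
  then show "fscale c w \<in> {w. \<exists>k. (\<forall>Q\<in>V. regular_at Q k) \<and> (\<forall>Q\<in>V. w Q = k Q * a Q)}"
    using regular_at_mult[OF regular_at_const[of _ c], of _ k]
    by (auto intro!: exI[of _ "\<lambda>Q. c * k Q"] simp: fscale_def)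
qed

text \<open>A local section is a combination of multiples of \<open>a\<close>, hence a multiple of
  \<open>a\<close>. As \<open>a\<close> is generically nonzero, the local coefficients agree
  generically and therefore, being regular, as germs; so they glue.\<close>

lemma generated_sheaf_multiples:
  assumes V: "openin (zar X) V" and W: "a \<in> W" "\<And>w. w \<in> W \<Longrightarrow> \<exists>k. (\<forall>Q\<in>V. regular_at Q k) \<and> (\<forall>Q\<in>V. w Q = k Q * a Q)"
    and a: "\<forall>\<^sub>F Q in generic. a Q \<noteq> 0"
  shows "generated_sheaf X W V = (\<lambda>f. f * a) ` struct_sheaf X V"
proof (intro equalityI subsetI)
  fix s assume "s \<in> (\<lambda>f. f * a) ` struct_sheaf X V"
  then obtain f where f: "f \<in> struct_sheaf X V" "s = f * a" by blast
  have "supported_on V s" using f struct_sheaf_iff[OF V] by (simp add: supported_on_def)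
  moreover have "\<exists>(n::nat) g w. (\<forall>i<n. g i \<in> struct_sheaf X V \<and> w i \<in> W) \<and> (\<forall>Q\<in>V. s Q = (\<Sum>i<n. g i Q * w i Q))"
    by (rule exI[of _ "Suc 0"], rule exI[of _ "\<lambda>_. f"], rule exI[of _ "\<lambda>_. a"]) (use f W(1) in simp)
  ultimately show "s \<in> generated_sheaf X W V" unfolding generated_sheaf_def using V by blast
next
  fix s assume "s \<in> generated_sheaf X W V"
  then have s: "supported_on V s"
    and loc: "\<forall>P\<in>V. \<exists>V'. openin (zar X) V' \<and> P \<in> V' \<and> V' \<subseteq> V \<and>
        (\<exists>(n::nat) f w. (\<forall>i<n. f i \<in> struct_sheaf X V' \<and> w i \<in> W) \<and>
           (\<forall>Q\<in>V'. s Q = (\<Sum>i<n. f i Q * w i Q)))"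
    unfolding generated_sheaf_def by blast+
  have "\<exists>f. regular_at P f \<and> (\<forall>\<^sub>F Q in near P. s Q = f Q * a Q)" if P: "P \<in> V" for P
  proof -
    obtain V' n f w where V': "openin (zar X) V'" "P \<in> V'" "V' \<subseteq> V"
      and f: "\<And>i. i < n \<Longrightarrow> f i \<in> struct_sheaf X V'" and w: "\<And>i. i < n \<Longrightarrow> w i \<in> W"
      and sum: "\<And>Q. Q \<in> V' \<Longrightarrow> s Q = (\<Sum>i<(n::nat). f i Q * w i Q)"
      using bspec[OF loc P] by blast
    have "\<forall>i. \<exists>k. i < n \<longrightarrow> (\<forall>Q\<in>V. regular_at Q k) \<and> (\<forall>Q\<in>V. w i Q = k Q * a Q)"
      using W(2)[OF w] by blast
    then obtain k where k: "\<And>i. i < n \<Longrightarrow> \<forall>Q\<in>V. regular_at Q (k i)"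
      "\<And>i. i < n \<Longrightarrow> \<forall>Q\<in>V. w i Q = k i Q * a Q" by metis
    have fr: "regular_at P (f i)" if "i < n" for i
      using f[OF that] struct_sheaf_iff[OF V'(1)] V'(2) by blast
    have "regular_at P (\<lambda>Q. \<Sum>i<n. f i Q * k i Q)"
      by (rule regular_at_sum, rule regular_at_mult) (use fr k(1) P in auto)
    moreover have "\<forall>\<^sub>F Q in near P. s Q = (\<Sum>i<n. f i Q * k i Q) * a Q"
      using near_open[OF V'(1,2)]
    proof eventually_elim
      case (elim Q)
      have "w i Q = k i Q * a Q" if "i < n" for i using k(2)[OF that] elim V'(3) by blast
      then show ?case using sum[OF elim] by (simp add: sum_distrib_right mult.assoc)
    qed
    ultimately show ?thesis by blast
  qed
  then obtain \<phi> where \<phi>: "\<And>P. P \<in> V \<Longrightarrow> regular_at P (\<phi> P)"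
    "\<And>P. P \<in> V \<Longrightarrow> \<forall>\<^sub>F Q in near P. s Q = \<phi> P Q * a Q" by metis
  \<comment> \<open>Each point receives the value of the coefficient found for that point; near
    \<open>P\<close> the result coincides with \<open>\<phi> P\<close> and is therefore
    regular.\<close>
  define f where "f P = (if P \<in> V then \<phi> P P else 0)" for P
  have VX: "P \<in> X" if "P \<in> V" for P using that openin_X_subset[OF V] by blast
  have "regular_at P f" if P: "P \<in> V" for P
  proof (rule regular_at_cong[OF _ \<phi>(1)[OF P]])
    from near_near[OF VX[OF P] \<phi>(2)[OF P]] regular_at_open[OF \<phi>(1)[OF P] VX[OF P]] near_open[OF V P]
    show "\<forall>\<^sub>F Q in near P. \<phi> P Q = f Q"
    proof eventually_elim
      case (elim Q)
      from near_imp_generic[OF VX[OF elim(3)] elim(1)] near_imp_generic[OF VX[OF elim(3)] \<phi>(2)[OF elim(3)]] a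
      have "\<forall>\<^sub>F Q' in generic. \<phi> P Q' = \<phi> Q Q'" by eventually_elim auto
      from regular_generic_eq[OF elim(2) \<phi>(1)[OF elim(3)] VX[OF elim(3)] this]
      have "\<phi> P Q = \<phi> Q Q" using near_imp_at[OF VX[OF elim(3)]] by blast
      then show ?case unfolding f_def using elim(3) by simp
    qed
  qed
  then have "f \<in> struct_sheaf X V" unfolding struct_sheaf_iff[OF V] by (simp add: supported_on_def f_def)
  moreover have "s = f * a"
  proof
    fix Q
    show "s Q = (f * a) Q"
    proof (cases "Q \<in> V")
      case True
      then show ?thesis using near_imp_at[OF VX[OF True] \<phi>(2)[OF True]] by (simp add: f_def)
    next
      case False
      then show ?thesis using s by (simp add: f_def supported_on_def)
    qed
  qed
  ultimately show "s \<in> (\<lambda>f. f * a) ` struct_sheaf X V" by blast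
qed

text \<open>If \<open>a\<close> divides \<open>b\<close> on \<open>V\<close>, it divides every
  member of the pencil and generates the sheaf alone. It is cut off outside \<open>V\<close> to meet
  the support convention for sections.\<close>

lemma generated_sheaf_frame:
  assumes V: "openin (zar X) V" "P \<in> V" and h: "\<And>Q. Q \<in> V \<Longrightarrow> regular_at Q h" "\<And>Q. Q \<in> V \<Longrightarrow> b Q = h Q * a Q"
    and a: "\<forall>\<^sub>F Q in generic. a Q \<noteq> 0"
  shows "frame X (generated_sheaf X (fun_vs.span {a, b})) V (restr V a)"
proof -
  define W where "W = fun_vs.span {a, b}"
  have aW: "a \<in> W" unfolding W_def by (simp add: fun_vs.span_base)
  have "{a, b} \<subseteq> {w. \<exists>k. (\<forall>Q\<in>V. regular_at Q k) \<and> (\<forall>Q\<in>V. w Q = k Q * a Q)}"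
    using exI[of "\<lambda>k. (\<forall>Q\<in>V. regular_at Q k) \<and> (\<forall>Q\<in>V. a Q = k Q * a Q)" "\<lambda>_. 1"]
      exI[of "\<lambda>k. (\<forall>Q\<in>V. regular_at Q k) \<and> (\<forall>Q\<in>V. b Q = k Q * a Q)" h] h regular_at_const[of _ 1]
    by simp
  then have W: "W \<subseteq> {w. \<exists>k. (\<forall>Q\<in>V. regular_at Q k) \<and> (\<forall>Q\<in>V. w Q = k Q * a Q)}"
    unfolding W_def by (rule fun_vs.span_minimal[OF _ subspace_multiples])
  have eq: "generated_sheaf X W V' = (\<lambda>f. f * restr V a) ` struct_sheaf X V'"
    if V': "openin (zar X) V'" "V' \<subseteq> V" for V'
  proof -
    have "generated_sheaf X W V' = (\<lambda>f. f * a) ` struct_sheaf X V'"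
    proof (rule generated_sheaf_multiples[OF V'(1) aW _ a])
      fix w assume "w \<in> W"
      then obtain k where "\<forall>Q\<in>V. regular_at Q k" "\<forall>Q\<in>V. w Q = k Q * a Q" using W by blast
      then show "\<exists>k. (\<forall>Q\<in>V'. regular_at Q k) \<and> (\<forall>Q\<in>V'. w Q = k Q * a Q)" using V'(2) by blast
    qed
    also have "\<dots> = (\<lambda>f. f * restr V a) ` struct_sheaf X V'"
    proof (rule image_cong[OF refl])
      fix f assume "f \<in> struct_sheaf X V'"
      then have "f Q = 0" if "Q \<notin> V" for Q
        using that V' struct_sheaf_iff[OF V'(1)] unfolding supported_on_def by blast
      then show "f * a = f * restr V a" by (auto simp: restr_def fun_eq_iff)
    qed
    finally show ?thesis .
  qed
  have "restr V (\<lambda>_. 1) \<in> struct_sheaf X V" unfolding struct_sheaf_iff[OF V(1)]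
    using regular_at_cong_open[OF V(1) _ _ regular_at_const[of _ 1], of _ "restr V (\<lambda>_. 1)"]
    by (simp add: supported_on_def restr_def)
  moreover have "restr V a = restr V (\<lambda>_. 1) * restr V a" by (auto simp: restr_def fun_eq_iff)
  ultimately have "restr V a \<in> generated_sheaf X W V" unfolding eq[OF V(1) order_refl]
    using image_eqI[of "restr V a" "\<lambda>f. f * restr V a" "restr V (\<lambda>_. 1)"] by blast
  moreover have "\<forall>\<^sub>F Q in generic. Q \<in> V" by (rule eventually_genericI[OF V(1)]) (use V(2) in auto)
  then have "\<forall>\<^sub>F Q in generic. Q \<in> V \<and> restr V a Q \<noteq> 0" using a by eventually_elim (simp add: restr_def)
  then have "\<exists>U. openin (zar X) U \<and> U \<noteq> {} \<and> U \<subseteq> V \<and> (\<forall>Q\<in>U. restr V a Q \<noteq> 0)"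
    unfolding eventually_generic by blast
  ultimately show ?thesis using eq V(1) unfolding frame_def W_def by blast
qed

end

section \<open>The degree of a pencil\<close>

context irreducible_variety
begin

text \<open>An order at one point already makes \<open>s\<close> a rational section: off the zeros
  of \<open>t\<close> the coefficient \<open>u t^n\<close> is regular even for negative
  \<open>n\<close>. On a smooth curve the assumption on uniformizers is
  \<open>uniformizer_generic_nonzero\<close>.\<close>

lemma has_order_rational_section:
  assumes "P \<in> X" "has_order X F P s n"
    and t: "\<And>t. uniformizer X P t \<Longrightarrow> \<forall>\<^sub>F Q in generic. t Q \<noteq> 0"
  shows "rational_section X F s" "\<forall>\<^sub>F Q in generic. s Q \<noteq> 0"
proof -
  obtain U e t u where U: "P \<in> U" "frame X F U e" "uniformizer X P t"
    "u \<in> local_ring X P" "u P \<noteq> 0" "eq_generic X s (\<lambda>Q. u Q * t Q powi n * e Q)"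
    using assms(2) unfolding has_order_def by (elim exE conjE)
  have tr: "regular_at P t"
    using U(3) unfolding uniformizer_def max_ideal_def local_ring_iff[OF assms(1)] by simp
  have ur: "regular_at P u" using U(4) local_ring_iff[OF assms(1)] by simp
  note t0 = t[OF U(3)]
  note gs = U(6)[unfolded eq_generic_iff]
  from gs t0 frame_nonzero[OF U(2)] near_imp_generic[OF assms(1) regular_at_nonzero(1)[OF ur assms(1) U(5)]]
  show "\<forall>\<^sub>F Q in generic. s Q \<noteq> 0" by eventually_elim simp
  from gs t0 near_imp_generic[OF assms(1) regular_at_open[OF tr assms(1)]]
    near_imp_generic[OF assms(1) regular_at_open[OF ur assms(1)]]
    near_imp_generic[OF assms(1) near_open[OF frame_open[OF U(2)] U(1)]]
  have "\<forall>\<^sub>F Q in generic. Q \<in> U \<and> regular_at Q t \<and> regular_at Q u \<and> t Q \<noteq> 0 \<and> s Q = u Q * t Q powi n * e Q"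
    by eventually_elim simp
  then obtain V where V: "openin (zar X) V" "V \<noteq> {}"
    "\<And>Q. Q \<in> V \<Longrightarrow> Q \<in> U \<and> regular_at Q t \<and> regular_at Q u \<and> t Q \<noteq> 0 \<and> s Q = u Q * t Q powi n * e Q"
    unfolding eventually_generic by auto
  define f where "f = restr V (\<lambda>Q. u Q * t Q powi n)"
  have "regular_at Q f" if Q: "Q \<in> V" for Q
  proof -
    have QX: "Q \<in> X" using Q openin_X_subset[OF V(1)] by blast
    have "regular_at Q (\<lambda>Q. t Q powi n)"
    proof (cases "n \<ge> 0")
      case True
      then show ?thesis using regular_at_power[of Q t "nat n"] V(3)[OF Q] by (simp add: power_int_def)
    next
      case False
      have "regular_at Q (\<lambda>Q. inverse (t Q))" using regular_at_nonzero(2)[OF _ QX] V(3)[OF Q] by simp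
      then show ?thesis using regular_at_power[of Q _ "nat (- n)"] False by (simp add: power_int_def)
    qed
    then have "regular_at Q (\<lambda>Q. u Q * t Q powi n)" using regular_at_mult V(3)[OF Q] by simp
    then show ?thesis by (rule regular_at_cong_open[OF V(1) Q, rotated]) (simp add: f_def restr_def)
  qed
  then have "f \<in> struct_sheaf X V" unfolding struct_sheaf_iff[OF V(1)] by (simp add: f_def restr_def supported_on_def)
  then have "f * e \<in> F V" using frame_sections[OF U(2) V(1)] V(3) by blast
  moreover have "restr V s = f * e" using V(3) by (auto simp: f_def restr_def fun_eq_iff)
  ultimately show "rational_section X F s" unfolding rational_section_def using V(1,2) by metis
qed

end

context smooth_curve
begin

text \<open>From \<open>\<rho> = w t^m e\<close> and \<open>c \<rho> = \<kappa> a\<close> the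
  section \<open>c s\<close> becomes \<open>(\<kappa> u / w) t^(n - m) a\<close>, and
  \<open>a\<close> is a frame since it divides \<open>b\<close> near \<open>P\<close>. The constant
  \<open>\<kappa>\<close> will be 1 or -1, according to whether the factor is read as
  \<open>a / \<rho>\<close> or as \<open>- b / \<sigma>\<close>.\<close>

lemma has_order_generated_sheaf:
  assumes P: "P \<in> C" and t: "uniformizer C P t" and u: "regular_at P u" "u P \<noteq> 0"
    and s: "\<forall>\<^sub>F Q in generic. s Q = u Q * t Q powi n * e Q" and e: "\<forall>\<^sub>F Q in generic. e Q \<noteq> 0"
    and w: "regular_at P w" "w P \<noteq> 0" "\<forall>\<^sub>F Q in near P. \<rho> Q = w Q * t Q ^ m * e Q"
    and h: "regular_at P h" "\<forall>\<^sub>F Q in near P. b Q = h Q * a Q"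
    and a: "\<forall>\<^sub>F Q in generic. a Q \<noteq> 0"
    and \<kappa>: "\<kappa> \<noteq> 0" and c: "\<forall>\<^sub>F Q in generic. c Q * \<rho> Q = \<kappa> * a Q"
    and W: "W = fun_vs.span {a, b}"
  shows "has_order C (generated_sheaf C W) P (\<lambda>Q. c Q * s Q) (n - int m)"
proof -
  obtain V where V: "openin (zar C) V" "P \<in> V" "\<And>Q. Q \<in> V \<Longrightarrow> regular_at Q h" "\<And>Q. Q \<in> V \<Longrightarrow> b Q = h Q * a Q"
    using eventually_conj[OF regular_at_open[OF h(1) P] h(2)] unfolding eventually_near[OF P] by auto
  define u' where "u' Q = \<kappa> * (u Q * inverse (w Q))" for Q
  have "regular_at P u'" unfolding u'_def
    using regular_at_mult[OF regular_at_const regular_at_mult[OF u(1) regular_at_nonzero(2)[OF w(1) P w(2)]]] .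
  moreover have "u' P \<noteq> 0" using u w \<kappa> by (simp add: u'_def)
  moreover have "\<forall>\<^sub>F Q in generic. c Q * s Q = u' Q * t Q powi (n - int m) * restr V a Q"
    using s e near_imp_generic[OF P w(3)] c uniformizer_generic_nonzero[OF P t]
      near_imp_generic[OF P regular_at_nonzero(1)[OF w(1) P w(2)]]
      near_imp_generic[OF P near_open[OF V(1,2)]]
  proof eventually_elim
    case (elim Q)
    have "c Q = \<kappa> * a Q / (w Q * t Q ^ m * e Q)"
      using elim(2,3,4,5,6) by (metis divide_eq_eq mult_eq_0_iff power_not_zero nonzero_mult_div_cancel_right)
    then show ?case using elim by (simp add: u'_def restr_def power_int_diff field_simps)
  qed
  ultimately show ?thesis unfolding has_order_def
    using V(2) generated_sheaf_frame[OF V a] t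
    by (intro exI[of _ V] exI[of _ "restr V a"] exI[of _ t] exI[of _ u'] conjI)
      (simp_all add: W local_ring_iff[OF P] eq_generic_iff)
qed

text \<open>Cancel the generically nonzero \<open>g\<close> in \<open>(p k + q) g = 0\<close>.
  Applied to coefficients in frames: if \<open>\<rho>\<close> divides \<open>\<sigma>\<close> near
  \<open>P\<close>, then \<open>a\<close> divides \<open>b\<close>, and likewise with both pairs
  exchanged.\<close>

lemma cofactor_multiple:
  assumes P: "P \<in> C" and pq: "regular_at P p" "regular_at P q" and k: "regular_at P k"
    and f: "\<forall>\<^sub>F Q in near P. f Q = k Q * g Q" and g: "\<forall>\<^sub>F Q in generic. g Q \<noteq> 0"
    and rel: "\<forall>\<^sub>F Q in generic. p Q * f Q + q Q * g Q = 0"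
  shows "\<forall>\<^sub>F Q in near P. q Q = - k Q * p Q"
proof (rule regular_generic_eq[OF pq(2) regular_at_mult[OF regular_at_uminus[OF k] pq(1)] P])
  from rel g near_imp_generic[OF P f] show "\<forall>\<^sub>F Q in generic. q Q = - k Q * p Q"
  proof eventually_elim
    case (elim Q)
    then have "(p Q * k Q + q Q) * g Q = 0" by (simp add: algebra_simps)
    then have "p Q * k Q + q Q = 0" using elim(2) by simp
    then show ?case by (simp add: eq_neg_iff_add_eq_0 algebra_simps)
  qed
qed

lemma order_quotient:
  assumes P: "P \<in> C" and t: "uniformizer C P t"
    and w: "regular_at P w" "w P \<noteq> 0" "\<forall>\<^sub>F Q in near P. f Q = w Q * t Q ^ m"
    and w': "regular_at P w'" "w' P \<noteq> 0" "\<forall>\<^sub>F Q in near P. g Q = w' Q * t Q ^ m'"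
    and le: "m' \<le> m"
  shows "\<exists>k. regular_at P k \<and> (\<forall>\<^sub>F Q in near P. f Q = k Q * g Q)"
proof (intro exI conjI)
  have "regular_at P t" using t uniformizer_iff[OF P] by blast
  then show "regular_at P (\<lambda>Q. w Q * inverse (w' Q) * t Q ^ (m - m'))"
    by (intro regular_at_mult regular_at_power w(1) regular_at_nonzero(2)[OF w'(1) P w'(2)])
  show "\<forall>\<^sub>F Q in near P. f Q = w Q * inverse (w' Q) * t Q ^ (m - m') * g Q"
    using w(3) w'(3) regular_at_nonzero(1)[OF w'(1) P w'(2)]
  proof eventually_elim
    case (elim Q)
    have "t Q ^ m = t Q ^ (m - m') * t Q ^ m'" using le by (simp flip: power_add)
    then show ?case using elim by simp
  qed
qed

text \<open>
  With \<open>\<sigma> = f e\<close> and \<open>\<rho> = g e\<close>, the relation makes the subsheaf generated by \<open>a, b\<close> isomorphic,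
  via the factor \<open>a / \<rho> = - b / \<sigma>\<close>, to the one generated by \<open>\<rho>, \<sigma>\<close>, which near \<open>P\<close> is \<open>t\<^sup>m e \<O>\<close>
  with \<open>m = min (ord f) (ord g)\<close>.
\<close>

lemma has_order_pencil:
  assumes P: "P \<in> C" and L: "line_bundle C L" and B: "line_bundle C B"
    and ab: "a \<in> H0 C L" "b \<in> H0 C L" "a \<noteq> 0" "b \<noteq> 0"
    and \<sigma>\<rho>: "\<sigma> \<in> H0 C B" "\<rho> \<in> H0 C B" "\<sigma> \<noteq> 0" "\<rho> \<noteq> 0"
    and rel: "a * \<sigma> + b * \<rho> = 0"
    and s: "has_order C B P s n"
    and fr: "frame C B U1 e1" "\<And>Q. Q \<in> U1 \<Longrightarrow> regular_at Q f1" "\<And>Q. Q \<in> U1 \<Longrightarrow> \<sigma> Q = f1 Q * e1 Q"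
  shows "\<exists>m::nat. has_order C (generated_sheaf C (fun_vs.span {a, b})) P (\<lambda>Q. a Q / \<rho> Q * s Q) (n - int m) \<and>
    (P \<in> U1 \<and> f1 P \<noteq> 0 \<longrightarrow> m = 0)"
proof -
  have mL: "module_sheaf C L" and mB: "module_sheaf C B" using L B unfolding line_bundle_def by auto
  note ga = nonzero_section_generic[OF L ab(1,3)] and gb = nonzero_section_generic[OF L ab(2,4)]
  note g\<sigma> = nonzero_section_generic[OF B \<sigma>\<rho>(1,3)] and g\<rho> = nonzero_section_generic[OF B \<sigma>\<rho>(2,4)]
  obtain U e t u where U: "P \<in> U" "frame C B U e" "uniformizer C P t"
    "u \<in> local_ring C P" "u P \<noteq> 0" "eq_generic C s (\<lambda>Q. u Q * t Q powi n * e Q)"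
    using s unfolding has_order_def by (elim exE conjE)
  have ur: "regular_at P u" using U(4) local_ring_iff[OF P] by simp
  note gs = U(6)[unfolded eq_generic_iff]
  obtain U2 e2 where U2: "P \<in> U2" "frame C L U2 e2"
    using bspec[OF conjunct2[OF L[unfolded line_bundle_def]] P] by (elim exE conjE)
  have UC: "U \<inter> C = U" "U2 \<inter> C = U2"
    using openin_X_subset frame_open U(2) U2(2) by blast+
  obtain f where f: "\<forall>P\<in>U. regular_at P f" "\<forall>P\<in>U. \<sigma> P = f P * e P"
    using section_in_frame[OF mB U(2) openin_X \<sigma>\<rho>(1)[unfolded H0_def]] unfolding UC by (elim exE conjE)
  obtain g where g: "\<forall>P\<in>U. regular_at P g" "\<forall>P\<in>U. \<rho> P = g P * e P"
    using section_in_frame[OF mB U(2) openin_X \<sigma>\<rho>(2)[unfolded H0_def]] unfolding UC by (elim exE conjE)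
  obtain p where p: "\<forall>P\<in>U2. regular_at P p" "\<forall>P\<in>U2. a P = p P * e2 P"
    using section_in_frame[OF mL U2(2) openin_X ab(1)[unfolded H0_def]] unfolding UC by (elim exE conjE)
  obtain q where q: "\<forall>P\<in>U2. regular_at P q" "\<forall>P\<in>U2. b P = q P * e2 P"
    using section_in_frame[OF mL U2(2) openin_X ab(2)[unfolded H0_def]] unfolding UC by (elim exE conjE)
  have fP: "regular_at P f" and gP: "regular_at P g" and pP: "regular_at P p" and qP: "regular_at P q"
    using f g p q U(1) U2(1) by auto
  have nU: "\<forall>\<^sub>F Q in near P. Q \<in> U" and nU2: "\<forall>\<^sub>F Q in near P. Q \<in> U2"
    using near_open frame_open U U2 by blast+
  note gU = near_imp_generic[OF P nU] and gU2 = near_imp_generic[OF P nU2]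
  note ge = frame_nonzero[OF U(2)] and ge2 = frame_nonzero[OF U2(2)]
  have gf: "\<forall>\<^sub>F Q in generic. f Q \<noteq> 0" using gU g\<sigma> by eventually_elim (use f in auto)
  have gg: "\<forall>\<^sub>F Q in generic. g Q \<noteq> 0" using gU g\<rho> by eventually_elim (use g in auto)
  have relQ: "a Q * \<sigma> Q + b Q * \<rho> Q = 0" for Q using fun_cong[OF rel, of Q] by simp
  have gr: "\<forall>\<^sub>F Q in generic. p Q * f Q + q Q * g Q = 0"
    using gU gU2 ge ge2
  proof eventually_elim
    case (elim Q)
    have eqs: "a Q = p Q * e2 Q" "b Q = q Q * e2 Q" "\<sigma> Q = f Q * e Q" "\<rho> Q = g Q * e Q"
      using elim f(2) g(2) p(2) q(2) by blast+
    have "(p Q * f Q + q Q * g Q) * (e Q * e2 Q) = 0"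
      using relQ[of Q] unfolding eqs by (simp add: algebra_simps)
    then show ?case using elim by simp
  qed
  obtain m w where w: "regular_at P w" "w P \<noteq> 0" "\<forall>\<^sub>F Q in near P. f Q = w Q * t Q ^ m"
    using regular_order[OF P U(3) fP gf] by (elim exE conjE)
  obtain m' w' where w': "regular_at P w'" "w' P \<noteq> 0" "\<forall>\<^sub>F Q in near P. g Q = w' Q * t Q ^ m'"
    using regular_order[OF P U(3) gP gg] by (elim exE conjE)
  have n\<sigma>: "\<forall>\<^sub>F Q in near P. \<sigma> Q = w Q * t Q ^ m * e Q"
    using w(3) nU by eventually_elim (use f(2) in simp)
  have n\<rho>: "\<forall>\<^sub>F Q in near P. \<rho> Q = w' Q * t Q ^ m' * e Q"
    using w'(3) nU by eventually_elim (use g(2) in simp)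
  \<comment> \<open>Here \<open>\<sigma>\<close> is measured in a frame given independently of the
    one at \<open>P\<close>. The two differ by a unit, so \<open>f1 P \<noteq> 0\<close> gives
    \<open>f P \<noteq> 0\<close> and order 0. This later confines the drop of the order to finitely
    many points.\<close>
  have good: "m = 0" if P1: "P \<in> U1" "f1 P \<noteq> 0"
  proof -
    obtain x where x: "regular_at P x" "x P \<noteq> 0" "\<forall>\<^sub>F Q in near P. e1 Q = x Q * e Q"
      using frame_ratio[OF mB U(2) fr(1) U(1) P1(1)] by (elim exE conjE)
    from near_imp_generic[OF P x(3)] near_imp_generic[OF P near_open[OF frame_open[OF fr(1)] P1(1)]] gU ge
    have "\<forall>\<^sub>F Q in generic. f Q = f1 Q * x Q"
    proof eventually_elim
      case (elim Q)
      have "f Q * e Q = f1 Q * x Q * e Q" using fr(3)[OF elim(2)] f(2) elim(1,3) by simp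
      then show ?case using elim(4) by simp
    qed
    from near_imp_at[OF P regular_generic_eq[OF fP regular_at_mult[OF fr(2)[OF P1(1)] x(1)] P this]]
    have "f P \<noteq> 0" using x(2) P1(2) by simp
    moreover have "f P = w P * t P ^ m" "t P = 0"
      using near_imp_at[OF P w(3)] U(3) uniformizer_iff[OF P] by simp_all
    ultimately show ?thesis by (metis mult_zero_right power_eq_0_iff gr0I)
  qed
  show ?thesis
  proof (cases "m' \<le> m")
    case True
    obtain k where k: "regular_at P k" "\<forall>\<^sub>F Q in near P. f Q = k Q * g Q"
      using order_quotient[OF P U(3) w w' True] by (elim exE conjE)
    from cofactor_multiple[OF P pP qP k gg gr] nU2 have nb: "\<forall>\<^sub>F Q in near P. b Q = - k Q * a Q"
      by eventually_elim (use p(2) q(2) in simp)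
    have gc: "\<forall>\<^sub>F Q in generic. a Q / \<rho> Q * \<rho> Q = 1 * a Q" using g\<rho> by eventually_elim simp
    have "has_order C (generated_sheaf C (fun_vs.span {a, b})) P (\<lambda>Q. a Q / \<rho> Q * s Q) (n - int m')"
      by (rule has_order_generated_sheaf[OF P U(3) ur U(5) gs ge w'(1,2) n\<rho> regular_at_uminus[OF k(1)]
          nb ga one_neq_zero gc refl])
    then show ?thesis using good True by (intro exI[of _ m']) auto
  next
    case False
    then have le: "m \<le> m'" by simp
    obtain k where k: "regular_at P k" "\<forall>\<^sub>F Q in near P. g Q = k Q * f Q"
      using order_quotient[OF P U(3) w' w le] by (elim exE conjE)
    have gr': "\<forall>\<^sub>F Q in generic. q Q * g Q + p Q * f Q = 0" using gr by (simp add: add.commute)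
    from cofactor_multiple[OF P qP pP k gf gr'] nU2 have na: "\<forall>\<^sub>F Q in near P. a Q = - k Q * b Q"
      by eventually_elim (use p(2) q(2) in simp)
    \<comment> \<open>Now \<open>b\<close> is the local generator, and the same factor
      \<open>a / \<rho>\<close> enters as \<open>- b / \<sigma>\<close>, whence the constant
      -1.\<close>
    have gc: "\<forall>\<^sub>F Q in generic. a Q / \<rho> Q * \<sigma> Q = (- 1) * b Q" using g\<rho>
    proof eventually_elim
      case (elim Q)
      have "a Q * \<sigma> Q = - (b Q * \<rho> Q)" using relQ[of Q] by (simp add: eq_neg_iff_add_eq_0)
      then show ?case using elim by (simp add: field_simps)
    qed
    have W: "fun_vs.span {a, b} = fun_vs.span {b, a}" by (simp add: insert_commute)
    have "has_order C (generated_sheaf C (fun_vs.span {a, b})) P (\<lambda>Q. a Q / \<rho> Q * s Q) (n - int m)"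
      by (rule has_order_generated_sheaf[OF P U(3) ur U(5) gs ge w(1,2) n\<sigma> regular_at_uminus[OF k(1)]
          na gb _ gc W]) simp
    then show ?thesis using good by (intro exI[of _ m]) auto
  qed
qed

theorem degree_pencil:
  assumes L: "line_bundle C L" and B: "line_bundle C B" "has_degree C B d"
    and ab: "a \<in> H0 C L" "b \<in> H0 C L" "a \<noteq> 0" "b \<noteq> 0"
    and \<sigma>\<rho>: "\<sigma> \<in> H0 C B" "\<rho> \<in> H0 C B" "\<sigma> \<noteq> 0" "\<rho> \<noteq> 0"
    and rel: "a * \<sigma> + b * \<rho> = 0"
  shows "\<exists>d'\<le>d. has_degree C (generated_sheaf C (fun_vs.span {a, b})) d'"
proof -
  let ?G = "generated_sheaf C (fun_vs.span {a, b})"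
  obtain s N where s: "\<forall>P\<in>C. has_order C B P s (N P)" "finite {P \<in> C. N P \<noteq> 0}"
    "d = (\<Sum>P | P \<in> C \<and> N P \<noteq> 0. N P)"
    using B(2) unfolding has_degree_def by (elim exE conjE)
  define s' where "s' Q = a Q / \<rho> Q * s Q" for Q
  have mB: "module_sheaf C B" using B unfolding line_bundle_def by auto
  \<comment> \<open>One frame around one point suffices: it is defined, with nonvanishing
    coefficient \<open>f1\<close> of \<open>\<sigma>\<close>, on a nonempty open set, and only the
    finitely many points outside can have \<open>m P \<noteq> 0\<close>.\<close>
  obtain P1 where P1: "P1 \<in> C" using irreducible unfolding irreducible_closed_def by blast
  then obtain U1 e1 where U1: "P1 \<in> U1" "frame C B U1 e1"
    using bspec[OF conjunct2[OF B(1)[unfolded line_bundle_def]] P1] by (elim exE conjE)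
  have UC: "U1 \<inter> C = U1" using openin_X_subset[OF frame_open[OF U1(2)]] by blast
  obtain f1 where f1: "\<forall>P\<in>U1. regular_at P f1" "\<forall>P\<in>U1. \<sigma> P = f1 P * e1 P"
    using section_in_frame[OF mB U1(2) openin_X \<sigma>\<rho>(1)[unfolded H0_def]] unfolding UC by (elim exE conjE)
  have "\<forall>P\<in>C. \<exists>m::nat. has_order C ?G P s' (N P - int m) \<and> (P \<in> U1 \<and> f1 P \<noteq> 0 \<longrightarrow> m = 0)"
    unfolding s'_def using has_order_pencil[OF _ L B(1) ab \<sigma>\<rho> rel _ U1(2)] s(1) f1 by blast
  then obtain m :: "_ \<Rightarrow> nat" where m: "\<And>P. P \<in> C \<Longrightarrow> has_order C ?G P s' (N P - int (m P))"
    "\<And>P. P \<in> C \<Longrightarrow> P \<in> U1 \<Longrightarrow> f1 P \<noteq> 0 \<Longrightarrow> m P = 0" by metis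
  have "\<forall>\<^sub>F Q in generic. Q \<in> U1" by (rule eventually_genericI[OF frame_open[OF U1(2)]]) (use U1(1) in auto)
  then have "\<forall>\<^sub>F Q in generic. Q \<in> U1 \<and> f1 Q \<noteq> 0"
    using nonzero_section_generic[OF B(1) \<sigma>\<rho>(1,3)] by eventually_elim (use f1(2) in auto)
  from generic_finite[OF this] have fin: "finite {P \<in> C. m P \<noteq> 0}"
  proof (rule rev_finite_subset, intro subsetI)
    fix P assume "P \<in> {P \<in> C. m P \<noteq> 0}"
    then show "P \<in> {Q \<in> C. \<not> (Q \<in> U1 \<and> f1 Q \<noteq> 0)}" using m(2)[of P] by auto
  qed
  \<comment> \<open>A common finite index set for both sums, as \<open>N P - m P\<close> may vanish
    where \<open>N P\<close> does not, and conversely.\<close>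
  let ?S = "{P \<in> C. N P \<noteq> 0} \<union> {P \<in> C. m P \<noteq> 0}"
  define d' where "d' = (\<Sum>P | P \<in> C \<and> N P - int (m P) \<noteq> 0. N P - int (m P))"
  have "finite ?S" using s(2) fin by simp
  then have "d' = (\<Sum>P\<in>?S. N P - int (m P))"
    unfolding d'_def by (intro sum.mono_neutral_left) auto
  also have "\<dots> \<le> (\<Sum>P\<in>?S. N P)" by (rule sum_mono) simp
  also have "\<dots> = d" unfolding s(3) using \<open>finite ?S\<close> by (intro sum.mono_neutral_right) auto
  finally have "d' \<le> d" .
  moreover have "has_degree C ?G d'"
  proof -
    have r: "rational_section C ?G s'" "\<forall>\<^sub>F Q in generic. s' Q \<noteq> 0"
      using has_order_rational_section[OF P1 m(1)[OF P1] uniformizer_generic_nonzero[OF P1]] by blast+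
    have "\<not> eq_generic C s' (\<lambda>_. 0)"
    proof
      assume "eq_generic C s' (\<lambda>_. 0)"
      from this[unfolded eq_generic_iff] r(2) have "\<forall>\<^sub>F Q in generic. False" by eventually_elim simp
      then show False using generic_nontrivial by (simp add: trivial_limit_def)
    qed
    moreover have "finite {P \<in> C. N P - int (m P) \<noteq> 0}"
      by (rule finite_subset[OF _ \<open>finite ?S\<close>]) auto
    ultimately show ?thesis unfolding has_degree_def
      using r(1) m(1) d'_def by (intro exI[of _ s'] exI[of _ "\<lambda>P. N P - int (m P)"] conjI ballI) auto
  qed
  ultimately show ?thesis by blast
qed

end

section \<open>The kernel of the multiplication map\<close>

definition tensor_eval :: "(('a \<Rightarrow> 'k::field) \<times> ('a \<Rightarrow> 'k) \<Rightarrow> 'k) \<Rightarrow> 'a \<Rightarrow> 'k" where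
  "tensor_eval c = (\<Sum>x | c x \<noteq> 0. fscale (c x) (fst x * snd x))"

lemma tensor_eval_superset:
  assumes "finite A" "{x. c x \<noteq> 0} \<subseteq> A"
  shows "tensor_eval c = (\<Sum>x\<in>A. fscale (c x) (fst x * snd x))"
  unfolding tensor_eval_def
  by (rule sum.mono_neutral_left) (use assms in \<open>auto simp: fscale_def fun_eq_iff\<close>)

lemma tensor_eval_linear:
  assumes "finite {x. c x \<noteq> 0}" "finite {x. c' x \<noteq> 0}"
  shows "tensor_eval (c + c') = tensor_eval c + tensor_eval c'"
    and "tensor_eval (c - c') = tensor_eval c - tensor_eval c'"
proof -
  define A where "A = {x. c x \<noteq> 0} \<union> {x. c' x \<noteq> 0}"
  have fin: "finite A" unfolding A_def using assms by simp
  have c: "tensor_eval c = (\<Sum>x\<in>A. fscale (c x) (fst x * snd x))"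
    and c': "tensor_eval c' = (\<Sum>x\<in>A. fscale (c' x) (fst x * snd x))"
    by (rule tensor_eval_superset[OF fin]; auto simp: A_def)+
  show "tensor_eval (c + c') = tensor_eval c + tensor_eval c'"
    unfolding c c' by (subst tensor_eval_superset[OF fin])
      (auto simp: A_def sum.distrib[symmetric] fscale_def algebra_simps fun_eq_iff sum_apply)
  show "tensor_eval (c - c') = tensor_eval c - tensor_eval c'"
    unfolding c c' by (subst tensor_eval_superset[OF fin])
      (auto simp: A_def sum_subtractf[symmetric] fscale_def algebra_simps fun_eq_iff sum_apply)
qed

lemma tensor_eval_fscale:
  assumes "finite {x. c x \<noteq> 0}"
  shows "tensor_eval (fscale k c) = fscale k (tensor_eval c)"
  unfolding tensor_eval_def[of c]
  by (subst tensor_eval_superset[OF assms])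
    (auto simp: sum_distrib_left fscale_def algebra_simps fun_eq_iff sum_apply)

lemma finite_pure: "finite {x. pure v w x \<noteq> (0 :: 'k::zero_neq_one)}"
  by (rule finite_subset[of _ "{(v, w)}"]) (auto simp: pure_def)

lemma finite_support_linear:
  fixes c c' :: "'b \<Rightarrow> 'k::field"
  assumes "finite {x. c x \<noteq> 0}"
  shows "finite {x. c' x \<noteq> 0} \<Longrightarrow> finite {x. (c + c') x \<noteq> 0}"
    and "finite {x. c' x \<noteq> 0} \<Longrightarrow> finite {x. (c - c') x \<noteq> 0}"
    and "finite {x. fscale k c x \<noteq> 0}"
proof -
  show "finite {x. fscale k c x \<noteq> 0}"
    by (rule finite_subset[OF _ assms]) (auto simp: fscale_def)
  assume "finite {x. c' x \<noteq> 0}"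
  then have fin: "finite ({x. c x \<noteq> 0} \<union> {x. c' x \<noteq> 0})" using assms by simp
  show "finite {x. (c + c') x \<noteq> 0}" "finite {x. (c - c') x \<noteq> 0}"
    by (rule finite_subset[OF _ fin]; auto)+
qed

lemma tensor_eval_pure: "tensor_eval (pure v w :: _ \<Rightarrow> 'k::field) = v * w"
  by (subst tensor_eval_superset[of "{(v, w)}"]) (auto simp: pure_def fscale_def fun_eq_iff)

text \<open>Evaluation kills the four kinds of generators. Finite support is carried along because
  linearity of the evaluation is proved for finite supports, a sum over an infinite set being 0 by
  convention.\<close>

lemma tensor_eval_relations:
  assumes "c \<in> bilinear_relations V W"
  shows "finite {x. c x \<noteq> 0} \<and> tensor_eval c = 0"
proof -
  let ?K = "{c :: ('a \<Rightarrow> 'b) \<times> ('a \<Rightarrow> 'b) \<Rightarrow> 'b. finite {x. c x \<noteq> 0} \<and> tensor_eval c = 0}"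
  note L = tensor_eval_linear tensor_eval_fscale finite_support_linear
  have "tensor_eval 0 = (0 :: 'a \<Rightarrow> 'b)" by (simp add: tensor_eval_def)
  then have "fun_vs.subspace ?K" unfolding fun_vs.subspace_def
    by (auto simp: L simp del: plus_fun_apply)
  moreover have "tensor_eval (pure (v + v') w - pure v w - pure v' w) = 0"
    "tensor_eval (pure v (w + w') - pure v w - pure v w') = 0"
    "tensor_eval (pure (fscale a v) w - fscale a (pure v w)) = 0"
    "tensor_eval (pure v (fscale a w) - fscale a (pure v w)) = 0"
    for v v' w w' :: "'a \<Rightarrow> 'b" and a
    by (simp_all add: L finite_pure tensor_eval_pure del: minus_apply)
      (simp_all add: fscale_def fun_eq_iff algebra_simps)
  then have "{pure (v + v') w - pure v w - pure v' w | v v' w. v \<in> V \<and> v' \<in> V \<and> w \<in> W} \<union>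
     {pure v (w + w') - pure v w - pure v w' | v w w'. v \<in> V \<and> w \<in> W \<and> w' \<in> W} \<union>
     {pure (fscale a v) w - fscale a (pure v w) | a v w. v \<in> V \<and> w \<in> W} \<union>
     {pure v (fscale a w) - fscale a (pure v w) | a v w. v \<in> V \<and> w \<in> W} \<subseteq> ?K"
    by (auto simp del: minus_apply intro!: finite_support_linear finite_pure)
  ultimately have "bilinear_relations V W \<subseteq> ?K"
    unfolding bilinear_relations_def by (intro fun_vs.span_minimal)
  then show ?thesis using assms by blast
qed

lemma bilinear_relationsI:
  shows "v \<in> V \<Longrightarrow> v' \<in> V \<Longrightarrow> w \<in> W \<Longrightarrow> pure (v + v') w - pure v w - pure v' w \<in> bilinear_relations V W"
    and "v \<in> V \<Longrightarrow> w \<in> W \<Longrightarrow> w' \<in> W \<Longrightarrow> pure v (w + w') - pure v w - pure v w' \<in> bilinear_relations V W"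
    and "v \<in> V \<Longrightarrow> w \<in> W \<Longrightarrow> pure (fscale a v) w - fscale a (pure v w) \<in> bilinear_relations V W"
    and "v \<in> V \<Longrightarrow> w \<in> W \<Longrightarrow> pure v (fscale a w) - fscale a (pure v w) \<in> bilinear_relations V W"
  unfolding bilinear_relations_def by (rule fun_vs.span_base; blast)+

lemma subspace_bilinear_relations: "fun_vs.subspace (bilinear_relations V W)"
  unfolding bilinear_relations_def by (rule fun_vs.subspace_span)

lemma pure_zero_relation:
  fixes V :: "('a \<Rightarrow> 'k::field) set"
  assumes "fun_vs.subspace V" "w \<in> W"
  shows "pure 0 w \<in> bilinear_relations V W"
proof -
  have "pure (fscale 0 0) w - fscale 0 (pure 0 w) = (pure 0 w :: _ \<Rightarrow> 'k)"
    by (simp add: fscale_def fun_eq_iff pure_def)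
  then show ?thesis
    using bilinear_relationsI(3)[OF fun_vs.subspace_0[OF assms(1)] assms(2), of 0] by simp
qed

text \<open>The formal sums congruent to some \<open>pure a \<sigma> + pure b \<rho>\<close> form a
  subspace. It contains each \<open>pure v w\<close>, by expanding \<open>w\<close> in
  \<open>\<sigma>, \<rho>\<close> and moving the scalars to the first factor, and hence the whole
  free space.\<close>

lemma tensor_two_generators:
  fixes V W :: "('a \<Rightarrow> 'k::field) set"
  assumes V: "fun_vs.subspace V" and W: "fun_vs.subspace W" and \<sigma>\<rho>: "\<sigma> \<in> W" "\<rho> \<in> W"
    and span: "W \<subseteq> fun_vs.span {\<sigma>, \<rho>}" and c: "c \<in> free_space (V \<times> W)"
  shows "\<exists>a\<in>V. \<exists>b\<in>V. c - (pure a \<sigma> + pure b \<rho>) \<in> bilinear_relations V W"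
proof -
  note R = subspace_bilinear_relations[of V W]
  note RI = bilinear_relationsI[where V = V and W = W]
  note Radd = fun_vs.subspace_add[OF R] and Rdiff = fun_vs.subspace_diff[OF R]
    and Rscale = fun_vs.subspace_scale[OF R]
  define S where "S = {c. \<exists>a\<in>V. \<exists>b\<in>V. c - (pure a \<sigma> + pure b \<rho>) \<in> bilinear_relations V W}"
  note zero = pure_zero_relation[OF V]
  have S: "fun_vs.subspace S" unfolding fun_vs.subspace_def
  proof (intro conjI ballI allI)
    have "0 - (pure 0 \<sigma> + pure 0 \<rho>) \<in> bilinear_relations V W"
      using Rdiff[OF fun_vs.subspace_0[OF R] Radd[OF zero[OF \<sigma>\<rho>(1)] zero[OF \<sigma>\<rho>(2)]]] .
    then show "0 \<in> S" unfolding S_def using fun_vs.subspace_0[OF V] by blast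
  next
    fix x y assume "x \<in> S" "y \<in> S"
    then obtain a b a' b' where *: "a \<in> V" "b \<in> V" "x - (pure a \<sigma> + pure b \<rho>) \<in> bilinear_relations V W"
      "a' \<in> V" "b' \<in> V" "y - (pure a' \<sigma> + pure b' \<rho>) \<in> bilinear_relations V W"
      unfolding S_def by blast
    have "x + y - (pure (a + a') \<sigma> + pure (b + b') \<rho>) =
      (x - (pure a \<sigma> + pure b \<rho>)) + (y - (pure a' \<sigma> + pure b' \<rho>))
      - (pure (a + a') \<sigma> - pure a \<sigma> - pure a' \<sigma>) - (pure (b + b') \<rho> - pure b \<rho> - pure b' \<rho>)"
      by (simp add: algebra_simps)
    also have "\<dots> \<in> bilinear_relations V W"
      by (rule Rdiff[OF Rdiff[OF Radd[OF *(3,6)] RI(1)[OF *(1,4) \<sigma>\<rho>(1)]] RI(1)[OF *(2,5) \<sigma>\<rho>(2)]])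
    finally show "x + y \<in> S" unfolding S_def using * fun_vs.subspace_add[OF V] by blast
  next
    fix k x assume "x \<in> S"
    then obtain a b where *: "a \<in> V" "b \<in> V" "x - (pure a \<sigma> + pure b \<rho>) \<in> bilinear_relations V W"
      unfolding S_def by blast
    have "fscale k x - (pure (fscale k a) \<sigma> + pure (fscale k b) \<rho>) =
      fscale k (x - (pure a \<sigma> + pure b \<rho>))
      - (pure (fscale k a) \<sigma> - fscale k (pure a \<sigma>)) - (pure (fscale k b) \<rho> - fscale k (pure b \<rho>))"
      by (simp add: fun_eq_iff fscale_def algebra_simps)
    also have "\<dots> \<in> bilinear_relations V W"
      by (rule Rdiff[OF Rdiff[OF Rscale[OF *(3)] RI(3)[OF *(1) \<sigma>\<rho>(1)]] RI(3)[OF *(2) \<sigma>\<rho>(2)]])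
    finally show "fscale k x \<in> S" unfolding S_def using * fun_vs.subspace_scale[OF V] by blast
  qed
  have pS: "pure v w \<in> S" if vw: "v \<in> V" "w \<in> W" for v w
  proof -
    obtain \<alpha> \<beta> where w: "w = fscale \<alpha> \<sigma> + fscale \<beta> \<rho>"
    proof -
      obtain \<alpha> where "w - fscale \<alpha> \<sigma> \<in> fun_vs.span {\<rho>}"
        using span vw(2) fun_vs.span_breakdown_eq by blast
      then obtain \<beta> where "w - fscale \<alpha> \<sigma> = fscale \<beta> \<rho>" unfolding fun_vs.span_singleton by blast
      then show thesis using that[of \<alpha> \<beta>] by (simp add: algebra_simps)
    qed
    have sc: "fscale \<alpha> \<sigma> \<in> W" "fscale \<beta> \<rho> \<in> W" using \<sigma>\<rho> fun_vs.subspace_scale[OF W] by auto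
    have "pure v w - (pure (fscale \<alpha> v) \<sigma> + pure (fscale \<beta> v) \<rho>) =
      (pure v (fscale \<alpha> \<sigma> + fscale \<beta> \<rho>) - pure v (fscale \<alpha> \<sigma>) - pure v (fscale \<beta> \<rho>))
      + (pure v (fscale \<alpha> \<sigma>) - fscale \<alpha> (pure v \<sigma>)) + (pure v (fscale \<beta> \<rho>) - fscale \<beta> (pure v \<rho>))
      - (pure (fscale \<alpha> v) \<sigma> - fscale \<alpha> (pure v \<sigma>)) - (pure (fscale \<beta> v) \<rho> - fscale \<beta> (pure v \<rho>))"
      unfolding w by (simp add: algebra_simps)
    also have "\<dots> \<in> bilinear_relations V W"
      by (rule Rdiff[OF Rdiff[OF Radd[OF Radd[OF RI(2)[OF vw(1) sc] RI(4)[OF vw(1) \<sigma>\<rho>(1)]]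
          RI(4)[OF vw(1) \<sigma>\<rho>(2)]] RI(3)[OF vw(1) \<sigma>\<rho>(1)]] RI(3)[OF vw(1) \<sigma>\<rho>(2)]])
    finally show ?thesis unfolding S_def using vw(1) fun_vs.subspace_scale[OF V] by blast
  qed
  have c_eq: "c = (\<Sum>x | c x \<noteq> 0. fscale (c x) (pure (fst x) (snd x)))"
  proof
    fix y
    have "finite {x. c x \<noteq> 0}" using c unfolding free_space_def by blast
    then have "c y = (\<Sum>x | c x \<noteq> 0. if x = y then c x else 0)" by (simp add: sum.delta')
    also have "\<dots> = (\<Sum>x | c x \<noteq> 0. fscale (c x) (pure (fst x) (snd x)) y)"
      by (rule sum.cong) (auto simp: fscale_def pure_def)
    finally show "c y = (\<Sum>x | c x \<noteq> 0. fscale (c x) (pure (fst x) (snd x))) y" by (simp add: sum_apply)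
  qed
  have "x \<in> V \<times> W" if "c x \<noteq> 0" for x
    using that c unfolding free_space_def supported_on_def by blast
  then have fs: "fst x \<in> V" "snd x \<in> W" if "c x \<noteq> 0" for x using that by (auto simp: mem_Times_iff)
  have "(\<Sum>x | c x \<noteq> 0. fscale (c x) (pure (fst x) (snd x))) \<in> S"
  proof (rule fun_vs.subspace_sum[OF S])
    fix x assume "x \<in> {x. c x \<noteq> 0}"
    then show "fscale (c x) (pure (fst x) (snd x)) \<in> S"
      using fun_vs.subspace_scale[OF S pS[OF fs]] by simp
  qed
  then have "c \<in> S" using c_eq by (rule ssubst[rotated])
  then show ?thesis unfolding S_def by blast
qed

context irreducible_variety
begin

section \<open>The multiplication map on global sections\<close>

lemma subspace_H0:
  assumes "module_sheaf X F"
  shows "fun_vs.subspace (H0 X F)"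
proof -
  note M = spec[OF assms[unfolded module_sheaf_def], of X, THEN mp, OF openin_X]
  have zero: "0 \<in> F X" by (rule conjunct1[OF M])
  have add: "s + t \<in> F X" if "s \<in> F X" "t \<in> F X" for s t
    by (rule bspec[OF bspec[OF M[THEN conjunct2, THEN conjunct2, THEN conjunct1] that(1)] that(2)])
  have mult: "f * s \<in> F X" if "f \<in> struct_sheaf X X" "s \<in> F X" for f s
    by (rule bspec[OF bspec[OF M[THEN conjunct2, THEN conjunct2, THEN conjunct2, THEN conjunct1] that(1)] that(2)])
  have "fscale c s \<in> F X" if s: "s \<in> F X" for c s
  proof -
    \<comment> \<open>Scalars act through constant sections of the structure sheaf, cut off outside
      \<open>X\<close>.\<close>
    have "restr X (\<lambda>_. c) \<in> struct_sheaf X X" unfolding struct_sheaf_iff[OF openin_X]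
      using regular_at_cong_open[OF openin_X _ _ regular_at_const[of _ c], of _ "restr X (\<lambda>_. c)"]
      by (simp add: supported_on_def restr_def)
    then have "restr X (\<lambda>_. c) * s \<in> F X" using mult s by simp
    moreover have "restr X (\<lambda>_. c) * s = fscale c s"
      using module_sheaf_supported[OF assms openin_X s]
      by (auto simp: restr_def fscale_def fun_eq_iff supported_on_def)
    ultimately show ?thesis by simp
  qed
  then show ?thesis unfolding fun_vs.subspace_def H0_def using zero add by simp
qed

text \<open>Representatives of a class differ by a relation, which evaluates to 0; this gives the
  uniqueness behind \<open>THE\<close>. For existence the value must be a section of the tensor
  sheaf, and the finite sum itself is a local expression with \<open>V = X\<close>.\<close>

lemma mult_map_eq:
  assumes F: "module_sheaf X F" and G: "module_sheaf X G"
    and T: "T \<in> tensor_space (H0 X F) (H0 X G)" and c: "c \<in> T"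
  shows "mult_map X F G T = tensor_eval c"
proof -
  obtain c0 where c0: "T = {c' \<in> free_space (H0 X F \<times> H0 X G). c' - c0 \<in> bilinear_relations (H0 X F) (H0 X G)}"
    "c0 \<in> free_space (H0 X F \<times> H0 X G)" using T unfolding tensor_space_def by blast
  have fin: "finite {x. c' x \<noteq> 0}" if "c' \<in> free_space (H0 X F \<times> H0 X G)" for c' :: "_ \<Rightarrow> 'k"
    using that unfolding free_space_def by blast
  have ev: "tensor_eval c' = tensor_eval c0" if "c' \<in> T" for c'
  proof -
    have "c' \<in> free_space (H0 X F \<times> H0 X G)" "c' - c0 \<in> bilinear_relations (H0 X F) (H0 X G)"
      using that c0(1) by auto
    then have "tensor_eval c' - tensor_eval c0 = 0"
      using tensor_eval_relations tensor_eval_linear(2)[OF fin fin[OF c0(2)]] by metis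
    then show ?thesis by simp
  qed
  have cf: "c \<in> free_space (H0 X F \<times> H0 X G)" using c c0(1) by blast
  have supp: "fst x \<in> F X \<and> snd x \<in> G X" if "c x \<noteq> 0" for x
  proof -
    have "x \<in> H0 X F \<times> H0 X G" using that cf unfolding free_space_def supported_on_def by blast
    then show ?thesis unfolding H0_def by (cases x) simp
  qed
  \<comment> \<open>The tensor sheaf asks for sums over \<open>i < n\<close>, so the support is
    enumerated; the scalars are absorbed into the first factors.\<close>
  obtain n :: nat and e where e: "{x. c x \<noteq> 0} = e ` {i. i < n}" "inj_on e {i. i < n}"
    using finite_imp_nat_seg_image_inj_on[OF fin[OF cf]] by blast
  have ce: "c (e i) \<noteq> 0" if "i < n" for i using e(1) that by blast
  have eq: "tensor_eval c Q = (\<Sum>i<n. fscale (c (e i)) (fst (e i)) Q * snd (e i) Q)" for Q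
    unfolding tensor_eval_def e(1) sum.reindex[OF e(2)]
    by (simp add: sum_apply fscale_def mult.assoc lessThan_def)
  have "supported_on X (tensor_eval c)"
    unfolding supported_on_def eq
  proof (intro allI impI sum.neutral ballI)
    fix Q i assume "Q \<notin> X" "i \<in> {..<n}"
    then have "snd (e i) Q = 0"
      using module_sheaf_supported[OF G openin_X, of "snd (e i)"] supp[OF ce] unfolding supported_on_def by simp
    then show "fscale (c (e i)) (fst (e i)) Q * snd (e i) Q = 0" by simp
  qed
  moreover have "fscale (c (e i)) (fst (e i)) \<in> F X" if "i < n" for i
    using fun_vs.subspace_scale[OF subspace_H0[OF F]] supp[OF ce[OF that]] unfolding H0_def by blast
  then have "\<exists>(n::nat) a b. (\<forall>i<n. a i \<in> F X \<and> b i \<in> G X) \<and> (\<forall>Q\<in>X. tensor_eval c Q = (\<Sum>i<n. a i Q * b i Q))"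
    using eq supp[OF ce]
    by (intro exI[of _ n] exI[of _ "\<lambda>i. fscale (c (e i)) (fst (e i))"] exI[of _ "\<lambda>i. snd (e i)"]) simp
  ultimately have "tensor_eval c \<in> H0 X (tensor_sheaf X F G)"
    unfolding H0_def tensor_sheaf_def using openin_X by blast
  then show ?thesis unfolding mult_map_def
  proof (intro the_equality conjI)
    show "\<exists>c'\<in>T. tensor_eval c = (\<Sum>x | c' x \<noteq> 0. fscale (c' x) (fst x * snd x))"
      using c unfolding tensor_eval_def by blast
  next
    fix u assume "u \<in> H0 X (tensor_sheaf X F G) \<and> (\<exists>c\<in>T. u = (\<Sum>x | c x \<noteq> 0. fscale (c x) (fst x * snd x)))"
    then show "u = tensor_eval c" using ev[OF c] ev unfolding tensor_eval_def[symmetric] by metis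
  qed
qed

text \<open>Two classes with equal image have representatives whose difference evaluates to 0
  without being a relation. Modulo relations it is
  \<open>a \<otimes> \<sigma> + b \<otimes> \<rho>\<close>, and \<open>a = b = 0\<close> would make
  it a relation after all.\<close>

lemma mult_map_kernel:
  assumes F: "module_sheaf X F" and G: "module_sheaf X G"
    and \<sigma>\<rho>: "\<sigma> \<in> H0 X G" "\<rho> \<in> H0 X G" and span: "H0 X G \<subseteq> fun_vs.span {\<sigma>, \<rho>}"
    and ninj: "\<not> inj_on (mult_map X F G) (tensor_space (H0 X F) (H0 X G))"
  shows "\<exists>a\<in>H0 X F. \<exists>b\<in>H0 X F. a * \<sigma> + b * \<rho> = 0 \<and> (a \<noteq> 0 \<or> b \<noteq> 0)"
proof -
  let ?V = "H0 X F" and ?W = "H0 X G"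
  let ?R = "bilinear_relations ?V ?W"
  note V = subspace_H0[OF F] and W = subspace_H0[OF G]
  note R = subspace_bilinear_relations[of ?V ?W]
  obtain T1 T2 where T: "T1 \<in> tensor_space ?V ?W" "T2 \<in> tensor_space ?V ?W" "T1 \<noteq> T2"
    "mult_map X F G T1 = mult_map X F G T2" using ninj unfolding inj_on_def by blast
  obtain c1 c2 where c: "c1 \<in> free_space (?V \<times> ?W)" "T1 = {c' \<in> free_space (?V \<times> ?W). c' - c1 \<in> ?R}"
    "c2 \<in> free_space (?V \<times> ?W)" "T2 = {c' \<in> free_space (?V \<times> ?W). c' - c2 \<in> ?R}"
    using T(1,2) unfolding tensor_space_def by blast
  have "c1 \<in> T1" "c2 \<in> T2" using c fun_vs.subspace_0[OF R] by auto
  then have ev: "tensor_eval c1 = tensor_eval c2"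
    using mult_map_eq[OF F G T(1)] mult_map_eq[OF F G T(2)] T(4) by metis
  have nR: "c1 - c2 \<notin> ?R"
  proof
    assume r: "c1 - c2 \<in> ?R"
    have "c' - c1 \<in> ?R \<longleftrightarrow> c' - c2 \<in> ?R" for c'
      using fun_vs.subspace_add[OF R _ r, of "c' - c1"] fun_vs.subspace_diff[OF R _ r, of "c' - c2"]
      by (auto simp: algebra_simps)
    then show False using T(3) c by simp
  qed
  have fin: "finite {x. c1 x \<noteq> 0}" "finite {x. c2 x \<noteq> 0}" using c unfolding free_space_def by auto
  have "c1 - c2 \<in> free_space (?V \<times> ?W)"
    using c finite_support_linear(2)[OF fin(1) fin(2)] unfolding free_space_def supported_on_def by auto
  from tensor_two_generators[OF V W \<sigma>\<rho> span this] obtain a b where ab: "a \<in> ?V" "b \<in> ?V"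
    "c1 - c2 - (pure a \<sigma> + pure b \<rho>) \<in> ?R" by blast
  define X where "X = a * \<sigma> + b * \<rho>"
  have "tensor_eval (c1 - c2 - (pure a \<sigma> + pure b \<rho>)) = tensor_eval c1 - tensor_eval c2 - X"
    unfolding X_def by (simp add: tensor_eval_linear finite_support_linear fin finite_pure tensor_eval_pure del: minus_apply plus_fun_apply)
  then have "X = 0" using conjunct2[OF tensor_eval_relations[OF ab(3)]] ev by simp
  then have "a * \<sigma> + b * \<rho> = 0" unfolding X_def .
  moreover have "a \<noteq> 0 \<or> b \<noteq> 0"
  proof (rule ccontr)
    assume "\<not> ?thesis"
    then have ab0: "a = 0" "b = 0" by auto
    note z = pure_zero_relation[OF V]
    have "c1 - c2 \<in> ?R"
      using fun_vs.subspace_add[OF R ab(3) fun_vs.subspace_add[OF R z[OF \<sigma>\<rho>(1)] z[OF \<sigma>\<rho>(2)]]]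
      unfolding ab0 by simp
    then show False using nR by simp
  qed
  ultimately show ?thesis using ab by blast
qed

end

theorem theorem1p4:
  fixes C :: "('k::{alg_closed_field, field_char_0}, 'n::finite) point set"
    and L B :: "('k, 'n) fun_sheaf"
    and g \<gamma> r :: nat and d :: int
  assumes "smooth_projective_curve C"
    and "genus C = g" and "g \<ge> 2"
    and "gonality C = \<gamma>"
    and "line_bundle C L" and "globally_generated C L" and "has_degree C L d"
    and "h0 C L = r + 1"
    and "line_bundle C B" and "has_degree C B (int \<gamma>)" and "h0 C B = 2"
    and "d > int (\<gamma> * r)"
    and "\<not> inj_on (mult_map C L B) (tensor_space (H0 C L) (H0 C B))"
  shows "\<not> linearly_semistable C L"
proof
  assume stable: "linearly_semistable C L"
  interpret smooth_curve C
    using assms(1) unfolding smooth_projective_curve_def by unfold_locales auto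
  have mL: "module_sheaf C L" and mB: "module_sheaf C B"
    using assms(5,9) unfolding line_bundle_def by auto
  note sL = subspace_H0[OF mL] and sB = subspace_H0[OF mB]
  obtain \<B> where \<B>: "\<B> \<subseteq> H0 C B" "fun_vs.independent \<B>" "H0 C B \<subseteq> fun_vs.span \<B>" "card \<B> = 2"
    using fun_vs.basis_exists[of "H0 C B"] assms(11) unfolding h0_def by metis
  then obtain \<sigma> \<rho> where \<sigma>\<rho>: "\<B> = {\<sigma>, \<rho>}" "\<sigma> \<noteq> \<rho>" by (auto simp: card_2_iff)
  have in_B: "\<sigma> \<in> H0 C B" "\<rho> \<in> H0 C B" using \<B>(1) \<sigma>\<rho>(1) by auto
  have ind: "\<rho> \<noteq> 0" "\<sigma> \<noteq> 0" "\<rho> \<notin> fun_vs.span {\<sigma>}"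
  proof -
    show "\<rho> \<noteq> 0" "\<sigma> \<noteq> 0" using \<B>(2) \<sigma>\<rho>(1) fun_vs.dependent_zero by blast+
    have "fun_vs.independent (insert \<rho> {\<sigma>})" using \<B>(2) \<sigma>\<rho>(1) by (simp add: insert_commute)
    then show "\<rho> \<notin> fun_vs.span {\<sigma>}" using \<sigma>\<rho>(2) by (subst (asm) fun_vs.independent_insert) auto
  qed
  obtain a b where ab: "a \<in> H0 C L" "b \<in> H0 C L" "a * \<sigma> + b * \<rho> = 0" "a \<noteq> 0 \<or> b \<noteq> 0"
    using mult_map_kernel[OF mL mB in_B _ assms(13)] \<B>(3) \<sigma>\<rho>(1) by blast
  \<comment> \<open>Both factors are generically nonzero, so the product is nonzero at some
    point.\<close>
  have no_zero_div: "x * y \<noteq> 0" if "x \<in> H0 C L" "x \<noteq> 0" "y \<in> H0 C B" "y \<noteq> 0" for x y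
  proof
    assume xy: "x * y = 0"
    have "\<forall>\<^sub>F Q in generic. False"
      using nonzero_section_generic[OF assms(5) that(1,2)] nonzero_section_generic[OF assms(9) that(3,4)]
    proof eventually_elim
      case (elim Q)
      then show ?case using fun_cong[OF xy, of Q] by simp
    qed
    then show False using generic_nontrivial by (simp add: trivial_limit_def)
  qed
  have "a \<noteq> 0" using ab no_zero_div[OF ab(2) _ in_B(2) ind(1)] by auto
  have "b \<noteq> 0" using ab no_zero_div[OF ab(1) _ in_B(1) ind(2)] by auto
  \<comment> \<open>If \<open>a = k b\<close>, the relation reads
    \<open>b (k \<sigma> + \<rho>) = 0\<close>, and cancelling \<open>b\<close> makes
    \<open>\<rho>\<close> a multiple of \<open>\<sigma>\<close>.\<close>
  have "a \<notin> fun_vs.span {b}"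
  proof
    assume "a \<in> fun_vs.span {b}"
    then obtain k where k: "a = fscale k b" unfolding fun_vs.span_singleton by blast
    have "b * (fscale k \<sigma> + \<rho>) = a * \<sigma> + b * \<rho>" unfolding k by (simp add: fscale_def fun_eq_iff algebra_simps)
    then have "fscale k \<sigma> + \<rho> = 0"
      using no_zero_div[OF ab(2) \<open>b \<noteq> 0\<close>, of "fscale k \<sigma> + \<rho>"] ab(3)
        fun_vs.subspace_add[OF sB fun_vs.subspace_scale[OF sB in_B(1)] in_B(2)] by auto
    then have "\<rho> = fscale (- k) \<sigma>" by (simp add: fscale_def fun_eq_iff eq_neg_iff_add_eq_0 add.commute)
    then show False using ind(3) unfolding fun_vs.span_singleton by blast
  qed
  moreover from this have "a \<noteq> b" using fun_vs.span_base[of b "{b}"] by auto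
  ultimately have indep: "fun_vs.independent {a, b}"
    using \<open>b \<noteq> 0\<close> by (subst fun_vs.independent_insert) (simp add: fun_vs.dependent_single)
  define W where "W = fun_vs.span {a, b}"
  have "card {a, b} = 2" using \<open>a \<noteq> b\<close> by simp
  then have dim: "fun_vs.dim W = 2" unfolding W_def using fun_vs.dim_span_eq_card_independent[OF indep] by simp
  have WL: "W \<subseteq> H0 C L" unfolding W_def by (rule fun_vs.span_minimal[OF _ sL]) (use ab in simp)
  \<comment> \<open>This permits clearing the denominator: division by 0 yields 0, so for
    \<open>r = 0\<close> the semistability inequality would say nothing about \<open>d\<close>. The
    independent pair \<open>a, b\<close> forces \<open>r + 1 \<ge> 2\<close>.\<close>
  have "r \<ge> 1"
  proof -
    obtain \<A> where \<A>: "H0 C L \<subseteq> fun_vs.span \<A>" "card \<A> = r + 1"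
      using fun_vs.basis_exists[of "H0 C L"] assms(8) unfolding h0_def by metis
    \<comment> \<open>An infinite set has \<open>card\<close> 0, which is not
      \<open>r + 1\<close>.\<close>
    then have "finite \<A>" by (metis card.infinite Suc_eq_plus1 nat.distinct(1))
    then have "card {a, b} \<le> card \<A>"
      using fun_vs.independent_span_bound[OF _ indep, of \<A>] \<A>(1) ab by auto
    then show ?thesis using \<A>(2) \<open>card {a, b} = 2\<close> by simp
  qed
  obtain d' where d': "d' \<le> int \<gamma>" "has_degree C (generated_sheaf C W) d'"
    using degree_pencil[OF assms(5,9,10) ab(1,2) \<open>a \<noteq> 0\<close> \<open>b \<noteq> 0\<close> in_B ind(2,1) ab(3)] unfolding W_def by blast
  \<comment> \<open>With \<open>w = 2\<close> the left side is \<open>d'\<close> itself, so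
    semistability gives \<open>d \<le> d' r \<le> \<gamma> r\<close>.\<close>
  have "real_of_int d' / (real 2 - 1) \<ge> real_of_int d / real r"
    using stable[unfolded linearly_semistable_def, rule_format, of r d W 2 d']
      assms(7,8) dim WL d'(2) fun_vs.subspace_span[of "{a, b}"] unfolding W_def by blast
  then have "real_of_int d \<le> real_of_int d' * real r" using \<open>r \<ge> 1\<close> by (simp add: field_simps)
  also have "\<dots> \<le> real \<gamma> * real r" using d'(1) by (intro mult_right_mono) auto
  finally have "real_of_int d \<le> real_of_int (int (\<gamma> * r))" by simp
  then show False using assms(12) by linarith
qed

end
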